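(* Let $\mathcal X$ be a representation-finite poset and $\mathcal P$ a finite poset. Then for any subset $\mathrm E\subseteq\mathrm{Emb}_{\mathcal X}^{\mathcal P}$ the invariants $\mathbf{mult}^{\mathrm E}_{\mathcal X,\mathcal P}$ and $\mathbf{dimh}^{\mathrm E}_{\mathcal X,\mathcal P}$ are equivalent.
   Context: Fix a field $k$. All posets are finite. For a finite poset $\mathcal P$, $\mathrm{mod}\,\mathcal P$ is the category of functors from $\mathcal P$ to finite-dimensional $k$-vector spaces; $\mathrm{Ind}\,\mathcal P$ is a set of representatives of isoclasses of indecomposable $\mathcal P$-modules, and $\mathcal P$ is representation-finite if $\mathrm{Ind}\,\mathcal P$ is finite. $\mathrm K_0^{\mathrm{sp}}(\mathcal P)$ is the split Grothendieck group (isoclasses $[M]$ modulo $[M\oplus N]=[M]+[N]$). An invariant on $\mathrm{mod}\,\mathcal P$ is a $\mathbb Z$-linear map $\Phi:\mathrm K_0^{\mathrm{sp}}(\mathcal P)\to\mathbb Z^I$ for some set $I$. Invariants $\Phi_1,\Phi_2$ are equivalent if there is an isomorphism $\varphi:\mathrm{Im}\,\Phi_1\to\mathrm{Im}\,\Phi_2$ with $\varphi\circ\Phi_1=\Phi_2$. An order-embedding $f:\mathcal X\to\mathcal P$ is a map with $x\le x'\iff f(x)\le f(x')$; $\mathrm{Emb}_{\mathcal X}^{\mathcal P}$ is the set of order-embeddings up to precomposition with automorphisms of $\mathcal X$ (fix one representative for each class). $f^*:\mathrm{mod}\,\mathcal P\to\mathrm{mod}\,\mathcal X$ is restriction along $f$.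 With $\mathrm I=\mathrm{Ind}\,\mathcal X$, the invariants $\mathbf{mult}^{\mathrm E}_{\mathcal X,\mathcal P},\mathbf{dimh}^{\mathrm E}_{\mathcal X,\mathcal P}:\mathrm K_0^{\mathrm{sp}}(\mathcal P)\to\mathbb Z^{\mathrm E\times\mathrm I}$ are given by $(\mathbf{mult}^{\mathrm E}_{\mathcal X,\mathcal P}(M))_{(f,U)}=$ multiplicity of $U$ as a direct summand of $f^*M$, and $(\mathbf{dimh}^{\mathrm E}_{\mathcal X,\mathcal P}(M))_{(f,U)}=\dim_k\mathrm{Hom}_{\mathcal X}(U,f^*M)$. *)

theory Defs
  imports
    "HOL.Vector_Spaces"
    "HOL-Library.Function_Algebras"
    "HOL-Algebra.Generated_Groups"
    "HOL-Algebra.Product_Groups"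
    "HOL-Algebra.Free_Abelian_Groups"
begin

text \<open>
  A finite poset is given by its order relation \<open>r\<close>; since \<open>r\<close> is reflexive, the underlying
  set is \<open>Field r\<close>. The empty poset is allowed.
\<close>

definition finite_poset :: "'p rel \<Rightarrow> bool" where
  "finite_poset r \<longleftrightarrow> finite r \<and> Partial_order r"

text \<open>
  Finite-dimensional vector spaces over \<open>'k\<close> are taken to be the finite-dimensional subspaces of
  the infinite-dimensional space \<open>nat \<Rightarrow> 'k\<close>. Every finite-dimensional vector space is isomorphic
  to one of these, so they form a category equivalent to that of all of them.
\<close>

type_synonym 'k vec = "nat \<Rightarrow> 'k"

global_interpretation vec: vector_space "\<lambda>(c::'k::field) (v::'k vec). \<lambda>i. c * v i"
  by unfold_locales (simp_all add: fun_eq_iff distrib_left distrib_right)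

definition fd_space :: "'k::field vec set \<Rightarrow> bool" where
  "fd_space V \<longleftrightarrow> vec.subspace V \<and> (\<exists>B. finite B \<and> vec.span B = V)"

definition linear_between :: "'k::field vec set \<Rightarrow> 'k vec set \<Rightarrow> ('k vec \<Rightarrow> 'k vec) \<Rightarrow> bool" where
  "linear_between V W f \<longleftrightarrow>
     f \<in> V \<rightarrow> W \<and>
     (\<forall>v\<in>V. \<forall>w\<in>V. f (v + w) = f v + f w) \<and>
     (\<forall>c. \<forall>v\<in>V. f (\<lambda>i. c * v i) = (\<lambda>i. c * f v i))"

text \<open>
  A module over \<open>r\<close> is a functor; \<open>trans_map M p q\<close> is the structure map for \<open>p \<le> q\<close>. The values
  of the two fields at arguments not required by \<open>r\<close> are irrelevant.
\<close>

record ('p, 'k) pmod =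
  pspace :: "'p \<Rightarrow> 'k vec set"
  trans_map :: "'p \<Rightarrow> 'p \<Rightarrow> 'k vec \<Rightarrow> 'k vec"

definition pmods :: "'p rel \<Rightarrow> ('p, 'k::field) pmod set" where
  "pmods r = {M.
     (\<forall>p\<in>Field r. fd_space (pspace M p)) \<and>
     (\<forall>(p, q)\<in>r. linear_between (pspace M p) (pspace M q) (trans_map M p q)) \<and>
     (\<forall>p\<in>Field r. \<forall>v\<in>pspace M p. trans_map M p p v = v) \<and>
     (\<forall>p q s. (p, q) \<in> r \<longrightarrow> (q, s) \<in> r \<longrightarrow>
        (\<forall>v\<in>pspace M p. trans_map M q s (trans_map M p q v) = trans_map M p s v))}"

text \<open>
  Natural transformations. Components are extended by zero outside their domains, so that a
  natural transformation is a unique family of total functions and \<open>Hom r M N\<close> is a linear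
  subspace of the space of all such families.
\<close>

definition Hom :: "'p rel \<Rightarrow> ('p, 'k::field) pmod \<Rightarrow> ('p, 'k) pmod \<Rightarrow> ('p \<Rightarrow> 'k vec \<Rightarrow> 'k vec) set" where
  "Hom r M N = {h.
     (\<forall>p\<in>Field r. linear_between (pspace M p) (pspace N p) (h p)) \<and>
     (\<forall>(p, q)\<in>r. \<forall>v\<in>pspace M p. h q (trans_map M p q v) = trans_map N p q (h p v)) \<and>
     (\<forall>p v. p \<notin> Field r \<or> v \<notin> pspace M p \<longrightarrow> h p v = 0)}"

global_interpretation nat_trans:
  vector_space "\<lambda>(c::'k::field) (h::'p \<Rightarrow> 'k vec \<Rightarrow> 'k vec). \<lambda>p v i. c * h p v i"
  by unfold_locales (simp_all add: fun_eq_iff distrib_left distrib_right)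

definition dim_Hom :: "'p rel \<Rightarrow> ('p, 'k::field) pmod \<Rightarrow> ('p, 'k) pmod \<Rightarrow> nat" where
  "dim_Hom r M N = nat_trans.dim (Hom r M N)"

definition pmod_iso :: "'p rel \<Rightarrow> ('p, 'k::field) pmod \<Rightarrow> ('p, 'k) pmod \<Rightarrow> bool" where
  "pmod_iso r M N \<longleftrightarrow> (\<exists>g\<in>Hom r M N. \<exists>h\<in>Hom r N M. \<forall>p\<in>Field r.
     (\<forall>v\<in>pspace M p. h p (g p v) = v) \<and> (\<forall>w\<in>pspace N p. g p (h p w) = w))"

definition zero_pmod :: "('p, 'k::field) pmod" where
  "zero_pmod = \<lparr>pspace = (\<lambda>_. {0}), trans_map = (\<lambda>_ _ v. v)\<rparr>"

text \<open>
  Direct sums are formed through the linear isomorphism between \<open>(nat \<Rightarrow> 'k) \<times> (nat \<Rightarrow> 'k)\<close> and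
  \<open>nat \<Rightarrow> 'k\<close> that puts the first vector at the even and the second one at the odd coordinates.
\<close>

definition vpair :: "'k vec \<Rightarrow> 'k vec \<Rightarrow> 'k vec" where
  "vpair v w = (\<lambda>i. if even i then v (i div 2) else w (i div 2))"

definition vfst :: "'k vec \<Rightarrow> 'k vec" where
  "vfst u = (\<lambda>i. u (2 * i))"

definition vsnd :: "'k vec \<Rightarrow> 'k vec" where
  "vsnd u = (\<lambda>i. u (2 * i + 1))"

definition dsum :: "('p, 'k::field) pmod \<Rightarrow> ('p, 'k) pmod \<Rightarrow> ('p, 'k) pmod" where
  "dsum M N = \<lparr>
     pspace = (\<lambda>p. {vpair v w |v w. v \<in> pspace M p \<and> w \<in> pspace N p}),
     trans_map = (\<lambda>p q u. vpair (trans_map M p q (vfst u)) (trans_map N p q (vsnd u)))\<rparr>"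

fun dsum_power :: "nat \<Rightarrow> ('p, 'k::field) pmod \<Rightarrow> ('p, 'k) pmod" where
  "dsum_power 0 U = zero_pmod"
| "dsum_power (Suc m) U = dsum U (dsum_power m U)"

definition indecomposables :: "'p rel \<Rightarrow> ('p, 'k::field) pmod set" where
  "indecomposables r = {M \<in> pmods r.
     \<not> pmod_iso r M zero_pmod \<and>
     (\<forall>N1\<in>pmods r. \<forall>N2\<in>pmods r. pmod_iso r M (dsum N1 N2) \<longrightarrow>
        pmod_iso r N1 zero_pmod \<or> pmod_iso r N2 zero_pmod)}"

definition summand_mult :: "'p rel \<Rightarrow> ('p, 'k::field) pmod \<Rightarrow> ('p, 'k) pmod \<Rightarrow> nat" where
  "summand_mult r U M = (GREATEST m. \<exists>N\<in>pmods r. pmod_iso r M (dsum (dsum_power m U) N))"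

definition representatives :: "('a \<Rightarrow> 'a \<Rightarrow> bool) \<Rightarrow> 'a set \<Rightarrow> 'a set \<Rightarrow> bool" where
  "representatives R A S \<longleftrightarrow> S \<subseteq> A \<and> (\<forall>a\<in>A. \<exists>!s\<in>S. R a s)"

text \<open>\<open>I\<close> is a possible choice of the set \<open>Ind r\<close>.\<close>

definition is_Ind :: "'p rel \<Rightarrow> ('p, 'k::field) pmod set \<Rightarrow> bool" where
  "is_Ind r I \<longleftrightarrow> representatives (pmod_iso r) (indecomposables r) I"

definition rep_finite :: "'k::field itself \<Rightarrow> 'p rel \<Rightarrow> bool" where
  "rep_finite _ r \<longleftrightarrow> (\<exists>I :: ('p, 'k) pmod set. is_Ind r I \<and> finite I)"

definition order_embeddings :: "'x rel \<Rightarrow> 'p rel \<Rightarrow> ('x \<Rightarrow> 'p) set" where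
  "order_embeddings X P = {f \<in> Field X \<rightarrow>\<^sub>E Field P.
     \<forall>x\<in>Field X. \<forall>y\<in>Field X. (x, y) \<in> X \<longleftrightarrow> (f x, f y) \<in> P}"

definition automorphisms :: "'x rel \<Rightarrow> ('x \<Rightarrow> 'x) set" where
  "automorphisms X = {s \<in> order_embeddings X X. bij_betw s (Field X) (Field X)}"

text \<open>\<open>F\<close> is a possible choice of the set \<open>Emb\<close>, one embedding for each class.\<close>

definition is_Emb :: "'x rel \<Rightarrow> 'p rel \<Rightarrow> ('x \<Rightarrow> 'p) set \<Rightarrow> bool" where
  "is_Emb X P F \<longleftrightarrow>
     representatives (\<lambda>f g. \<exists>s\<in>automorphisms X. \<forall>x\<in>Field X. g x = f (s x))
       (order_embeddings X P) F"

definition restrict_along :: "('x \<Rightarrow> 'p) \<Rightarrow> ('p, 'k::field) pmod \<Rightarrow> ('x, 'k) pmod" where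
  "restrict_along f M =
     \<lparr>pspace = (\<lambda>x. pspace M (f x)), trans_map = (\<lambda>x y. trans_map M (f x) (f y))\<rparr>"

definition isoclass :: "'p rel \<Rightarrow> ('p, 'k::field) pmod \<Rightarrow> ('p, 'k) pmod set" where
  "isoclass r M = {N \<in> pmods r. pmod_iso r M N}"

definition free_isoclasses :: "'p rel \<Rightarrow> (('p, 'k::field) pmod set \<Rightarrow>\<^sub>0 int) monoid" where
  "free_isoclasses r = free_Abelian_group (isoclass r ` pmods r)"

definition split_relations :: "'p rel \<Rightarrow> (('p, 'k::field) pmod set \<Rightarrow>\<^sub>0 int) set" where
  "split_relations r = generate (free_isoclasses r)
     {frag_of (isoclass r (dsum M N)) - (frag_of (isoclass r M) + frag_of (isoclass r N)) |M N.
        M \<in> pmods r \<and> N \<in> pmods r}"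

definition K0sp :: "'p rel \<Rightarrow> (('p, 'k::field) pmod set \<Rightarrow>\<^sub>0 int) set monoid" where
  "K0sp r = free_isoclasses r Mod split_relations r"

definition K0_class :: "'p rel \<Rightarrow> ('p, 'k::field) pmod \<Rightarrow> (('p, 'k) pmod set \<Rightarrow>\<^sub>0 int) set" where
  "K0_class r M = split_relations r #>\<^bsub>free_isoclasses r\<^esub> frag_of (isoclass r M)"

text \<open>The group of all functions \<open>J \<rightarrow> \<int>\<close>, represented by functions that are undefined off \<open>J\<close>.\<close>

abbreviation int_power :: "'j set \<Rightarrow> ('j \<Rightarrow> int) monoid" where
  "int_power J \<equiv> product_group J (\<lambda>_. integer_group)"

definition invariant_on ::
  "'p rel \<Rightarrow> 'j set \<Rightarrow> ((('p, 'k::field) pmod set \<Rightarrow>\<^sub>0 int) set \<Rightarrow> 'j \<Rightarrow> int) \<Rightarrow> bool" where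
  "invariant_on r J \<Phi> \<longleftrightarrow> \<Phi> \<in> hom (K0sp r) (int_power J)"

definition equivalent_invariants ::
  "'p rel \<Rightarrow> 'i set \<Rightarrow> ((('p, 'k::field) pmod set \<Rightarrow>\<^sub>0 int) set \<Rightarrow> 'i \<Rightarrow> int)
    \<Rightarrow> 'j set \<Rightarrow> ((('p, 'k) pmod set \<Rightarrow>\<^sub>0 int) set \<Rightarrow> 'j \<Rightarrow> int) \<Rightarrow> bool" where
  "equivalent_invariants r J1 \<Phi>1 J2 \<Phi>2 \<longleftrightarrow>
     invariant_on r J1 \<Phi>1 \<and> invariant_on r J2 \<Phi>2 \<and>
     (\<exists>\<phi> \<in> iso ((int_power J1)\<lparr>carrier := \<Phi>1 ` carrier (K0sp r)\<rparr>)
                ((int_power J2)\<lparr>carrier := \<Phi>2 ` carrier (K0sp r)\<rparr>).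
        \<forall>c\<in>carrier (K0sp r). \<phi> (\<Phi>1 c) = \<Phi>2 c)"

text \<open>
  The \<open>\<int>\<close>-linear map \<open>K0sp r \<rightarrow> \<int>\<^sup>J\<close> given by \<open>[M] \<mapsto> (\<phi> M j)\<^sub>j\<close>. It is unique since the classes
  \<open>[M]\<close> generate \<open>K0sp r\<close>; it exists when \<open>\<phi>\<close> is isomorphism invariant and additive on direct
  sums. Note that \<open>equivalent_invariants\<close> requires both maps to be homomorphisms.
\<close>

definition K0_extend ::
  "'p rel \<Rightarrow> 'j set \<Rightarrow> (('p, 'k::field) pmod \<Rightarrow> 'j \<Rightarrow> int)
    \<Rightarrow> (('p, 'k) pmod set \<Rightarrow>\<^sub>0 int) set \<Rightarrow> 'j \<Rightarrow> int" where
  "K0_extend r J \<phi> = (THE \<Phi>.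
     \<Phi> \<in> extensional (carrier (K0sp r)) \<and> \<Phi> \<in> hom (K0sp r) (int_power J) \<and>
     (\<forall>M\<in>pmods r. \<Phi> (K0_class r M) = restrict (\<phi> M) J))"

definition mult_invariant ::
  "'x rel \<Rightarrow> 'p rel \<Rightarrow> ('x \<Rightarrow> 'p) set \<Rightarrow> ('x, 'k::field) pmod set
    \<Rightarrow> (('p, 'k) pmod set \<Rightarrow>\<^sub>0 int) set \<Rightarrow> ('x \<Rightarrow> 'p) \<times> ('x, 'k) pmod \<Rightarrow> int" where
  "mult_invariant X P E I =
     K0_extend P (E \<times> I) (\<lambda>M (f, U). int (summand_mult X U (restrict_along f M)))"

definition dimh_invariant ::
  "'x rel \<Rightarrow> 'p rel \<Rightarrow> ('x \<Rightarrow> 'p) set \<Rightarrow> ('x, 'k::field) pmod set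
    \<Rightarrow> (('p, 'k) pmod set \<Rightarrow>\<^sub>0 int) set \<Rightarrow> ('x \<Rightarrow> 'p) \<times> ('x, 'k) pmod \<Rightarrow> int" where
  "dimh_invariant X P E I =
     K0_extend P (E \<times> I) (\<lambda>M (f, U). int (dim_Hom X U (restrict_along f M)))"

end

theory Submission
  imports Defs
begin

text \<open>
  Write \<open>[U,M]\<close> for the dimension of the space of homomorphisms from \<open>U\<close> to \<open>M\<close>. Both invariants are
  homomorphisms on the split Grothendieck group, so they are equivalent as soon as each of them
  determines the other (\<open>equivalent_invariants_if_same_fibres\<close>). The two can be compared for one
  embedding \<open>f\<close> at a time, and thus for modules over the poset \<open>X\<close>.

  In one direction, \<open>[U,M]\<close> is the sum of \<open>[U,V] mult(V,M)\<close> over the indecomposables \<open>V\<close>, because a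
  module is the direct sum of its indecomposable summands (\<open>dim_Hom_from_mult\<close>).

  In the other direction the idea is Auslander's. As there are only finitely many
  indecomposables, one can form, for an indecomposable \<open>U\<close>, a homomorphism \<open>u\<close> from \<open>U\<close> to a finite direct
  sum \<open>E\<close> of the others through which every homomorphism from \<open>U\<close> to another indecomposable factors.
  Since the endomorphism ring of \<open>U\<close> is local, the identity of \<open>U\<close> does not factor through \<open>u\<close>
  (\<open>left_almost_split\<close>). Let \<open>C\<close> be the cokernel of \<open>u\<close>. By exactness \<open>[U,M] - [E,M] + [C,M]\<close> is the
  codimension in \<open>Hom(U,M)\<close> of the homomorphisms that factor through \<open>u\<close>. This is an additive function
  of \<open>M\<close> that is zero on the indecomposables other than \<open>U\<close> and a positive number \<open>e\<close> on \<open>U\<close>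
  (\<open>counting_functional_exists\<close>), hence it equals \<open>e mult(U,M)\<close> (\<open>summand_mult_eq\<close>). Decomposing \<open>E\<close> and
  \<open>C\<close> writes it as an integral combination of the numbers \<open>[V,M]\<close>, and \<open>e\<close> can be cancelled in the
  integers. The same formula shows that multiplicities are additive, which is the
  uniqueness part of the Krull-Schmidt theorem.
\<close>

section \<open>Linear algebra in finite-dimensional subspaces\<close>

text \<open>
  All families of maps form an infinite-dimensional space, in which the homomorphisms between two
  modules are a finite-dimensional subspace. Dimensions are therefore counted for subspaces of the
  span of a finite set.
\<close>

lemma (in vector_space) finite_basis_exists:
  assumes "S \<subseteq> span B" "finite B"
  obtains K where "K \<subseteq> S" "independent K" "finite K" "S \<subseteq> span K" "card K = dim S"
proof -
  obtain K where K: "K \<subseteq> S" "independent K" "S \<subseteq> span K" "card K = dim S"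
    using basis_exists[of S] by blast
  then have "finite K"
    using independent_span_bound[OF assms(2), of K] assms(1) by auto
  with K show thesis using that by blast
qed

lemma (in vector_space) card_independent_le_dim:
  assumes "S \<subseteq> span B" "finite B" "independent K" "K \<subseteq> S"
  shows "finite K \<and> card K \<le> dim S"
proof -
  obtain C where "C \<subseteq> S" "finite C" "S \<subseteq> span C" "card C = dim S"
    using finite_basis_exists[OF assms(1,2)] by metis
  with assms independent_span_bound[of C K] show ?thesis by auto
qed

lemma (in vector_space) subspace_eq_if_dim_le:
  assumes "T \<subseteq> span B" "finite B" "S \<subseteq> T" "subspace S" "dim T \<le> dim S"
  shows "S = T"
proof (rule ccontr)
  assume "S \<noteq> T"
  then obtain t where t: "t \<in> T" "t \<notin> S" using assms(3) by blast
  obtain K where K: "K \<subseteq> S" "independent K" "finite K" "S \<subseteq> span K" "card K = dim S"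
    using finite_basis_exists[of S B] assms(1-3) by (metis order_trans)
  have "span K \<subseteq> S" using K(1) assms(4) by (simp add: span_minimal)
  then have "t \<notin> span K" using t by blast
  then have "independent (insert t K)" "t \<notin> K"
    using K(2) independent_insertI span_base by blast+
  then have "Suc (dim S) \<le> dim T"
    using card_independent_le_dim[OF assms(1,2), of "insert t K"] K t assms(3) by auto
  then show False using assms(5) by simp
qed

text \<open>
  Rank-nullity. The map is only assumed to be linear on the subspace, because composition
  with a homomorphism from the left is linear only on homomorphisms. The proof replaces it by a
  linear map of the whole space that agrees with it on a basis extending a basis of the kernel.
\<close>

lemma (in vector_space) dim_kernel_image:
  assumes S: "subspace S" "S \<subseteq> span B" "finite B"
    and add: "\<And>x y. x \<in> S \<Longrightarrow> y \<in> S \<Longrightarrow> T (x + y) = T x + T y"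
    and scale: "\<And>c x. x \<in> S \<Longrightarrow> T (scale c x) = scale c (T x)"
  shows "dim S = dim {x \<in> S. T x = 0} + dim (T ` S)"
proof -
  interpret vector_space_pair scale scale ..
  let ?N = "{x \<in> S. T x = 0}"
  obtain K where K: "K \<subseteq> ?N" "independent K" "finite K" "?N \<subseteq> span K" "card K = dim ?N"
    using finite_basis_exists[of ?N B] S(2,3) by blast
  obtain L where L: "K \<subseteq> L" "L \<subseteq> S" "independent L" "S \<subseteq> span L"
    using maximal_independent_subset_extend[of K S] K by blast
  have finL: "finite L" using card_independent_le_dim[OF S(2,3) L(3,2)] by simp
  have spanL: "span L = S" using L S(1) by (simp add: span_minimal subset_antisym)
  have T0: "T 0 = 0" using scale[of 0 0] subspace_0[OF S(1)] by simp
  define f where "f = construct L T"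
  have f: "Vector_Spaces.linear scale scale f" using linear_construct[OF L(3)] by (simp add: f_def)
  have fT: "f x = T x" if "x \<in> S" for x
  proof -
    have "x \<in> span L" using that spanL by simp
    then have "x \<in> S \<and> f x = T x"
    proof (induct rule: span_induct_alt)
      case base
      then show ?case using T0 linear_0[OF f] subspace_0[OF S(1)] by simp
    next
      case (step c x y)
      have "x \<in> S" using step L by blast
      moreover have "f x = T x" using construct_basis[OF L(3)] step by (simp add: f_def)
      ultimately show ?case using step S(1)
        by (simp add: add scale linear_add[OF f] linear_scale[OF f] subspace_add subspace_scale)
    qed
    then show ?thesis by simp
  qed
  let ?D = "L - K"
  \<comment> \<open>A vector in the span of \<open>K\<close> and in the span of the rest of \<open>L\<close> has no nonzero coordinate.\<close>
  have zero: "x = 0" if "x \<in> span ?D" "f x = 0" for x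
  proof -
    have xS: "x \<in> S" using that(1) spanL span_mono[of ?D L] by blast
    then have xK: "x \<in> span K" using K(4) that(2) fT by auto
    have "representation L x b = 0" for b
      using representation_extend[OF L(3) xK L(1)] representation_extend[OF L(3) that(1)]
        representation_ne_zero[of K x b] representation_ne_zero[of ?D x b] by auto
    then show ?thesis
      using sum_nonzero_representation_eq[OF L(3), of x] xS spanL by auto
  qed
  have inj: "inj_on f (span ?D)"
    using zero linear_inj_on_iff_eq_0[OF f subspace_span] by blast
  have ind: "independent (f ` ?D)"
    using linear_independent_injective_image[OF f _ inj] independent_mono[OF L(3)] by blast
  have cardD: "card (f ` ?D) = card ?D"
    using inj span_superset by (metis card_image inj_on_subset)
  have "f ` L \<subseteq> insert 0 (f ` ?D)" using K(1) fT by auto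
  then have "span (f ` L) \<subseteq> span (f ` ?D)" by (metis span_insert_0 span_mono)
  then have "f ` S \<subseteq> span (f ` ?D)" using linear_span_image[OF f, of L] spanL by simp
  moreover have "f ` S = T ` S" using fT by auto
  moreover have "f ` ?D \<subseteq> f ` S" using L by blast
  ultimately have "dim (T ` S) = card ?D"
    using dim_unique[of "f ` ?D" "T ` S"] ind cardD by simp
  moreover have "dim S = card L" using L basis_card_eq_dim by metis
  ultimately show ?thesis using K(5) finL L(1)
    by (metis add.commute card_Diff_subset card_mono finite_subset le_add_diff_inverse2)
qed

lemma (in vector_space) dim_zero_subspace [simp]: "dim {0} = 0"
  using dim_span_eq_card_independent[OF independent_empty] by simp

text \<open>
  A subspace is the kernel of a linear projection. This allows a quotient to be realised as
  a complement, that is, as a space of the same type.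
\<close>

lemma (in vector_space) projection_with_kernel:
  assumes S: "subspace S"
  obtains \<pi> where "Vector_Spaces.linear scale scale \<pi>" "\<And>v. v \<in> S \<Longrightarrow> \<pi> v = 0" "\<And>v. v - \<pi> v \<in> S"
proof -
  interpret vector_space_pair scale scale ..
  obtain g where g: "g ` UNIV \<subseteq> S" "Vector_Spaces.linear scale scale g" "\<forall>v\<in>S. g v = v"
    using linear_exists_left_inverse_on[OF linear_id S, of ] by (auto simp: inj_on_def)
  show thesis
  proof
    show "Vector_Spaces.linear scale scale (\<lambda>v. v - g v)"
      using linear_compose_sub[OF linear_id g(2)] by simp
    show "v - g v = 0" if "v \<in> S" for v using g(3) that by simp
    show "v - (v - g v) \<in> S" for v using g(1) by auto
  qed
qed

section \<open>The category of modules\<close>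

lemma fd_spaceI:
  assumes "vec.subspace V" "V \<subseteq> vec.span B" "finite B"
  shows "fd_space V"
  using vec.finite_basis_exists[OF assms(2,3)] assms(1)
  unfolding fd_space_def by (metis vec.span_minimal subset_antisym)

lemma pmods_0: "M \<in> pmods r \<Longrightarrow> p \<in> Field r \<Longrightarrow> 0 \<in> pspace M p"
  and pmods_add: "M \<in> pmods r \<Longrightarrow> p \<in> Field r \<Longrightarrow> v \<in> pspace M p \<Longrightarrow> w \<in> pspace M p \<Longrightarrow> v + w \<in> pspace M p"
  and pmods_scale: "M \<in> pmods r \<Longrightarrow> p \<in> Field r \<Longrightarrow> v \<in> pspace M p \<Longrightarrow> (\<lambda>i. c * v i) \<in> pspace M p"
  unfolding pmods_def fd_space_def vec.subspace_def by auto

lemma trans_in: "M \<in> pmods r \<Longrightarrow> (p, q) \<in> r \<Longrightarrow> v \<in> pspace M p \<Longrightarrow> trans_map M p q v \<in> pspace M q"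
  and trans_add: "M \<in> pmods r \<Longrightarrow> (p, q) \<in> r \<Longrightarrow> v \<in> pspace M p \<Longrightarrow> w \<in> pspace M p \<Longrightarrow>
    trans_map M p q (v + w) = trans_map M p q v + trans_map M p q w"
  and trans_scale: "M \<in> pmods r \<Longrightarrow> (p, q) \<in> r \<Longrightarrow> v \<in> pspace M p \<Longrightarrow>
    trans_map M p q (\<lambda>i. c * v i) = (\<lambda>i. c * trans_map M p q v i)"
  and trans_id: "M \<in> pmods r \<Longrightarrow> p \<in> Field r \<Longrightarrow> v \<in> pspace M p \<Longrightarrow> trans_map M p p v = v"
  and trans_comp: "M \<in> pmods r \<Longrightarrow> (p, q) \<in> r \<Longrightarrow> (q, s) \<in> r \<Longrightarrow> v \<in> pspace M p \<Longrightarrow>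
    trans_map M q s (trans_map M p q v) = trans_map M p s v"
  unfolding pmods_def linear_between_def by blast+

lemma pmods_fd: "M \<in> pmods r \<Longrightarrow> p \<in> Field r \<Longrightarrow> fd_space (pspace M p)"
  unfolding pmods_def by blast

lemma pmodsI:
  assumes "\<And>p. p \<in> Field r \<Longrightarrow> fd_space (pspace M p)"
    and "\<And>p q v. (p, q) \<in> r \<Longrightarrow> v \<in> pspace M p \<Longrightarrow> trans_map M p q v \<in> pspace M q"
    and "\<And>p q v w. (p, q) \<in> r \<Longrightarrow> v \<in> pspace M p \<Longrightarrow> w \<in> pspace M p \<Longrightarrow>
      trans_map M p q (v + w) = trans_map M p q v + trans_map M p q w"
    and "\<And>p q v c. (p, q) \<in> r \<Longrightarrow> v \<in> pspace M p \<Longrightarrow>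
      trans_map M p q (\<lambda>i. c * v i) = (\<lambda>i. c * trans_map M p q v i)"
    and "\<And>p v. p \<in> Field r \<Longrightarrow> v \<in> pspace M p \<Longrightarrow> trans_map M p p v = v"
    and "\<And>p q s v. (p, q) \<in> r \<Longrightarrow> (q, s) \<in> r \<Longrightarrow> v \<in> pspace M p \<Longrightarrow>
      trans_map M q s (trans_map M p q v) = trans_map M p s v"
  shows "M \<in> pmods r"
  using assms unfolding pmods_def linear_between_def by blast

lemma Hom_in: "h \<in> Hom r M N \<Longrightarrow> p \<in> Field r \<Longrightarrow> v \<in> pspace M p \<Longrightarrow> h p v \<in> pspace N p"
  and Hom_add: "h \<in> Hom r M N \<Longrightarrow> p \<in> Field r \<Longrightarrow> v \<in> pspace M p \<Longrightarrow> w \<in> pspace M p \<Longrightarrow>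
    h p (v + w) = h p v + h p w"
  and Hom_scale: "h \<in> Hom r M N \<Longrightarrow> p \<in> Field r \<Longrightarrow> v \<in> pspace M p \<Longrightarrow>
    h p (\<lambda>i. c * v i) = (\<lambda>i. c * h p v i)"
  and Hom_natural: "h \<in> Hom r M N \<Longrightarrow> (p, q) \<in> r \<Longrightarrow> v \<in> pspace M p \<Longrightarrow>
    h q (trans_map M p q v) = trans_map N p q (h p v)"
  and Hom_outside: "h \<in> Hom r M N \<Longrightarrow> \<not> (p \<in> Field r \<and> v \<in> pspace M p) \<Longrightarrow> h p v = 0"
  unfolding Hom_def linear_between_def by blast+

lemma HomI:
  assumes "\<And>p v. p \<in> Field r \<Longrightarrow> v \<in> pspace M p \<Longrightarrow> h p v \<in> pspace N p"
    and "\<And>p v w. p \<in> Field r \<Longrightarrow> v \<in> pspace M p \<Longrightarrow> w \<in> pspace M p \<Longrightarrow> h p (v + w) = h p v + h p w"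
    and "\<And>p v c. p \<in> Field r \<Longrightarrow> v \<in> pspace M p \<Longrightarrow> h p (\<lambda>i. c * v i) = (\<lambda>i. c * h p v i)"
    and "\<And>p q v. (p, q) \<in> r \<Longrightarrow> p \<in> Field r \<Longrightarrow> q \<in> Field r \<Longrightarrow> v \<in> pspace M p \<Longrightarrow>
      h q (trans_map M p q v) = trans_map N p q (h p v)"
    and "\<And>p v. \<not> (p \<in> Field r \<and> v \<in> pspace M p) \<Longrightarrow> h p v = 0"
  shows "h \<in> Hom r M N"
  using assms unfolding Hom_def linear_between_def by (blast intro: FieldI1 FieldI2)

text \<open>
  Also true where the component is zero by convention, so that composition
  of families of maps needs no case distinction.
\<close>

lemma Hom_0: assumes "h \<in> Hom r M N" shows "h p 0 = 0"
proof (cases "p \<in> Field r \<and> 0 \<in> pspace M p")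
  case True
  then have "h p (\<lambda>i. 0 * (0::'b vec) i) = (\<lambda>i. 0 * h p 0 i)" using Hom_scale[OF assms] by blast
  then show ?thesis by (simp add: zero_fun_def)
qed (use Hom_outside[OF assms] in blast)

text \<open>
  Since homomorphisms vanish outside their domains, the pointwise composite is already
  normalised in the same way.
\<close>

definition hcomp :: "('p \<Rightarrow> 'k vec \<Rightarrow> 'k vec) \<Rightarrow> ('p \<Rightarrow> 'k vec \<Rightarrow> 'k vec) \<Rightarrow> 'p \<Rightarrow> 'k vec \<Rightarrow> 'k vec"
    (infixl "\<bullet>" 75) where
  "h \<bullet> g = (\<lambda>p v. h p (g p v))"

definition hid :: "'p rel \<Rightarrow> ('p, 'k::field) pmod \<Rightarrow> 'p \<Rightarrow> 'k vec \<Rightarrow> 'k vec" where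
  "hid r M = (\<lambda>p v. if p \<in> Field r \<and> v \<in> pspace M p then v else 0)"

lemma hcomp_assoc: "h \<bullet> g \<bullet> f = h \<bullet> (g \<bullet> f)"
  by (simp add: hcomp_def)

lemma hcomp_Hom:
  assumes h: "h \<in> Hom r N L" and g: "g \<in> Hom r M N" shows "h \<bullet> g \<in> Hom r M L"
proof (rule HomI)
  show "(h \<bullet> g) p v \<in> pspace L p" if "p \<in> Field r" "v \<in> pspace M p" for p v
    unfolding hcomp_def using Hom_in[OF h] Hom_in[OF g] that by blast
  show "(h \<bullet> g) p (v + w) = (h \<bullet> g) p v + (h \<bullet> g) p w"
    if "p \<in> Field r" "v \<in> pspace M p" "w \<in> pspace M p" for p v w
    unfolding hcomp_def using Hom_add[OF h that(1)] Hom_add[OF g that] Hom_in[OF g] that by metis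
  show "(h \<bullet> g) p (\<lambda>i. c * v i) = (\<lambda>i. c * (h \<bullet> g) p v i)"
    if "p \<in> Field r" "v \<in> pspace M p" for p v c
    unfolding hcomp_def using Hom_scale[OF h that(1)] Hom_scale[OF g that] Hom_in[OF g] that by metis
  show "(h \<bullet> g) q (trans_map M p q v) = trans_map L p q ((h \<bullet> g) p v)"
    if "(p, q) \<in> r" "p \<in> Field r" "v \<in> pspace M p" for p q v
    unfolding hcomp_def using Hom_natural[OF h that(1)] Hom_natural[OF g that(1,3)] Hom_in[OF g] that by metis
  show "(h \<bullet> g) p v = 0" if "\<not> (p \<in> Field r \<and> v \<in> pspace M p)" for p v
    unfolding hcomp_def using Hom_outside[OF g that] Hom_0[OF h] by simp
qed

lemma hid_Hom: "M \<in> pmods r \<Longrightarrow> hid r M \<in> Hom r M M"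
  by (rule HomI) (auto simp: hid_def pmods_add pmods_scale trans_in)

lemma hcomp_hid_right: "h \<in> Hom r M N \<Longrightarrow> h \<bullet> hid r M = h"
  unfolding hcomp_def hid_def using Hom_0[of h r M N] Hom_outside[of h r M N] by fastforce

lemma hcomp_hid_left: "h \<in> Hom r M N \<Longrightarrow> hid r N \<bullet> h = h"
  unfolding hcomp_def hid_def using Hom_in[of h r M N] Hom_outside[of h r M N] by fastforce

lemma hcomp_add_left: "(h + h') \<bullet> g = h \<bullet> g + h' \<bullet> g"
  by (simp add: hcomp_def fun_eq_iff)

lemma hcomp_diff_left: "(h - h') \<bullet> g = h \<bullet> g - h' \<bullet> g"
  by (simp add: hcomp_def fun_eq_iff)

lemma hcomp_scale_left: "(\<lambda>p v i. c * h p v i) \<bullet> g = (\<lambda>p v i. c * (h \<bullet> g) p v i)"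
  by (simp add: hcomp_def fun_eq_iff)

lemma hcomp_add_right:
  assumes "h \<in> Hom r N L" "g \<in> Hom r M N" "g' \<in> Hom r M N"
  shows "h \<bullet> (g + g') = h \<bullet> g + h \<bullet> g'"
proof (rule ext, rule ext)
  fix p v
  show "(h \<bullet> (g + g')) p v = (h \<bullet> g + h \<bullet> g') p v" 
    using Hom_add[OF assms(1)] Hom_in[OF assms(2)] Hom_in[OF assms(3)] Hom_outside[OF assms(2)]
      Hom_outside[OF assms(3)] Hom_0[OF assms(1)]
    by (cases "p \<in> Field r \<and> v \<in> pspace M p") (auto simp: hcomp_def)
qed

lemma hcomp_scale_right:
  assumes "h \<in> Hom r N L" "g \<in> Hom r M N"
  shows "h \<bullet> (\<lambda>p v i. c * g p v i) = (\<lambda>p v i. c * (h \<bullet> g) p v i)"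
proof (intro ext)
  fix p v i
  show "(h \<bullet> (\<lambda>p v i. c * g p v i)) p v i = c * (h \<bullet> g) p v i" 
    using Hom_scale[OF assms(1)] Hom_in[OF assms(2)] Hom_outside[OF assms(2)] Hom_0[OF assms(1), of p]
    by (cases "p \<in> Field r \<and> v \<in> pspace M p") (auto simp: hcomp_def zero_fun_def)
qed

lemma hcomp_0_left [simp]: "0 \<bullet> g = 0"
  by (simp add: hcomp_def fun_eq_iff)

lemma hcomp_0_right: "h \<in> Hom r N L \<Longrightarrow> h \<bullet> 0 = 0"
  by (simp add: hcomp_def fun_eq_iff Hom_0)

lemma subspace_Hom:
  assumes "N \<in> pmods r" shows "nat_trans.subspace (Hom r M N)"
proof -
  have tr0: "trans_map N p q 0 = 0" if "(p, q) \<in> r" for p q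
    using trans_scale[OF assms that pmods_0[OF assms], of 0] that
    by (auto simp: zero_fun_def intro: FieldI1)
  show ?thesis
    unfolding nat_trans.subspace_def
  proof (intro conjI ballI allI)
    show "0 \<in> Hom r M N"
      by (rule HomI) (auto simp: pmods_0[OF assms] tr0 zero_fun_def[symmetric])
  next
    fix g h assume g: "g \<in> Hom r M N" and h: "h \<in> Hom r M N"
    show "g + h \<in> Hom r M N"
    proof (rule HomI)
      show "(g + h) q (trans_map M p q v) = trans_map N p q ((g + h) p v)"
        if "(p, q) \<in> r" "p \<in> Field r" "v \<in> pspace M p" for p q v
        using that by (simp add: trans_add[OF assms] Hom_in[OF g] Hom_in[OF h] Hom_natural[OF g] Hom_natural[OF h])
      show "(g + h) p (\<lambda>i. c * v i) = (\<lambda>i. c * (g + h) p v i)"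
        if "p \<in> Field r" "v \<in> pspace M p" for p v c
        using that by (simp add: Hom_scale[OF g] Hom_scale[OF h] fun_eq_iff distrib_left)
    qed (simp_all add: pmods_add[OF assms] Hom_in[OF g] Hom_in[OF h] Hom_add[OF g] Hom_add[OF h]
        Hom_outside[OF g] Hom_outside[OF h])
  next
    fix g c assume g: "g \<in> Hom r M N"
    show "(\<lambda>p v i. c * g p v i) \<in> Hom r M N"
    proof (rule HomI)
      show "(\<lambda>i. c * g q (trans_map M p q v) i) = trans_map N p q (\<lambda>i. c * g p v i)"
        if "(p, q) \<in> r" "p \<in> Field r" "v \<in> pspace M p" for p q v
        using that by (simp add: trans_scale[OF assms] Hom_in[OF g] Hom_natural[OF g])
      show "(\<lambda>i. c * g p (v + w) i) = (\<lambda>i. c * g p v i) + (\<lambda>i. c * g p w i)"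
        if "p \<in> Field r" "v \<in> pspace M p" "w \<in> pspace M p" for p v w
        using that by (auto simp: Hom_add[OF g] distrib_left)
      show "(\<lambda>i. c * g p (\<lambda>i. d * v i) i) = (\<lambda>i. d * (c * g p v i))"
        if "p \<in> Field r" "v \<in> pspace M p" for p v d
        using that by (simp add: Hom_scale[OF g] mult.left_commute)
      show "(\<lambda>i. c * g p v i) = 0" if "\<not> (p \<in> Field r \<and> v \<in> pspace M p)" for p v
        using Hom_outside[OF g that] by (simp add: zero_fun_def)
    qed (simp add: pmods_scale[OF assms] Hom_in[OF g])
  qed
qed

lemma Hom_zero_in: "N \<in> pmods r \<Longrightarrow> 0 \<in> Hom r M N"
  and Hom_plus: "N \<in> pmods r \<Longrightarrow> g \<in> Hom r M N \<Longrightarrow> h \<in> Hom r M N \<Longrightarrow> g + h \<in> Hom r M N"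
  and Hom_minus: "N \<in> pmods r \<Longrightarrow> g \<in> Hom r M N \<Longrightarrow> h \<in> Hom r M N \<Longrightarrow> g - h \<in> Hom r M N"
  by (simp_all add: subspace_Hom nat_trans.subspace_0 nat_trans.subspace_add nat_trans.subspace_diff)

lemma hcomp_diff_right:
  assumes "N \<in> pmods r" "h \<in> Hom r N L" "g \<in> Hom r M N" "g' \<in> Hom r M N"
  shows "h \<bullet> (g - g') = h \<bullet> g - h \<bullet> g'"
  using hcomp_add_right[OF assms(2) Hom_minus[OF assms(1,3,4)] assms(4)]
  by (simp add: eq_diff_eq)

text \<open>
  Isomorphism expressed by equations between homomorphisms. All later arguments about
  isomorphisms compute with such equations instead of with vectors.
\<close>

lemma pmod_iso_iff:
  "pmod_iso r M N \<longleftrightarrow> (\<exists>g\<in>Hom r M N. \<exists>h\<in>Hom r N M. h \<bullet> g = hid r M \<and> g \<bullet> h = hid r N)"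
proof -
  have *: "h \<bullet> g = hid r M \<longleftrightarrow> (\<forall>p\<in>Field r. \<forall>v\<in>pspace M p. h p (g p v) = v)"
    if "g \<in> Hom r M N" "h \<in> Hom r N M" for g h and M N :: "('a, 'b) pmod"
  proof
    assume hg: "h \<bullet> g = hid r M"
    have "h p (g p v) = hid r M p v" for p v
      using fun_cong[OF fun_cong[OF hg]] by (simp add: hcomp_def)
    then show "\<forall>p\<in>Field r. \<forall>v\<in>pspace M p. h p (g p v) = v" by (simp add: hid_def)
  next
    assume *: "\<forall>p\<in>Field r. \<forall>v\<in>pspace M p. h p (g p v) = v"
    show "h \<bullet> g = hid r M"
    proof (rule ext, rule ext)
      fix p v
      show "(h \<bullet> g) p v = hid r M p v"
        using * Hom_outside[OF that(1), of p v] Hom_0[OF that(2), of p]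
        by (cases "p \<in> Field r \<and> v \<in> pspace M p") (auto simp: hcomp_def hid_def)
    qed
  qed
  show ?thesis unfolding pmod_iso_def using * by blast
qed

lemma pmod_iso_refl: "M \<in> pmods r \<Longrightarrow> pmod_iso r M M"
  unfolding pmod_iso_iff using hid_Hom[of M r] hcomp_hid_left[of "hid r M" r M M] by blast

lemma pmod_iso_sym: "pmod_iso r M N \<Longrightarrow> pmod_iso r N M"
  unfolding pmod_iso_iff by blast

lemma pmod_iso_trans:
  assumes "pmod_iso r L M" "pmod_iso r M N" shows "pmod_iso r L N"
proof -
  obtain g h where 1: "g \<in> Hom r L M" "h \<in> Hom r M L" "h \<bullet> g = hid r L" "g \<bullet> h = hid r M"
    using assms(1) unfolding pmod_iso_iff by blast
  obtain g' h' where 2: "g' \<in> Hom r M N" "h' \<in> Hom r N M" "h' \<bullet> g' = hid r M" "g' \<bullet> h' = hid r N"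
    using assms(2) unfolding pmod_iso_iff by blast
  have "(h \<bullet> h') \<bullet> (g' \<bullet> g) = h \<bullet> (h' \<bullet> g' \<bullet> g)" "(g' \<bullet> g) \<bullet> (h \<bullet> h') = g' \<bullet> (g \<bullet> h \<bullet> h')"
    by (simp_all add: hcomp_assoc)
  then have "(h \<bullet> h') \<bullet> (g' \<bullet> g) = hid r L" "(g' \<bullet> g) \<bullet> (h \<bullet> h') = hid r N"
    using 1 2 by (simp_all add: hcomp_hid_left)
  then show ?thesis
    unfolding pmod_iso_iff using hcomp_Hom[OF 2(1) 1(1)] hcomp_Hom[OF 1(2) 2(2)] by blast
qed

lemma zero_pmod: "zero_pmod \<in> pmods r"
proof (rule pmodsI)
  show "fd_space (pspace zero_pmod p)" for p
    using vec.span_empty unfolding fd_space_def zero_pmod_def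
    by (auto intro!: exI[of _ "{}"] simp: vec.subspace_single_0)
qed (auto simp: zero_pmod_def)

lemma Hom_to_zero: "h \<in> Hom r M zero_pmod \<Longrightarrow> h = 0"
proof (rule ext, rule ext)
  fix p v
  assume h: "h \<in> Hom r M zero_pmod"
  show "h p v = (0 :: 'a \<Rightarrow> 'b vec \<Rightarrow> 'b vec) p v"
    using Hom_in[OF h, of p v] Hom_outside[OF h, of p v]
    by (cases "p \<in> Field r \<and> v \<in> pspace M p") (auto simp: zero_pmod_def)
qed

lemma pmod_iso_zero_iff:
  assumes "M \<in> pmods r" shows "pmod_iso r M zero_pmod \<longleftrightarrow> hid r M = 0"
proof
  assume "pmod_iso r M zero_pmod"
  then obtain g h where "g \<in> Hom r M zero_pmod" "h \<in> Hom r zero_pmod M" "h \<bullet> g = hid r M"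
    unfolding pmod_iso_iff by blast
  then show "hid r M = 0" using Hom_to_zero[of g r M] hcomp_0_right[of h r zero_pmod M] by simp
next
  have "hid r zero_pmod = (0 :: 'a \<Rightarrow> 'b vec \<Rightarrow> 'b vec)"
    using Hom_to_zero[OF hid_Hom[OF zero_pmod]] .
  moreover assume "hid r M = 0"
  ultimately show "pmod_iso r M zero_pmod"
    unfolding pmod_iso_iff using Hom_zero_in[OF assms] Hom_zero_in[OF zero_pmod]
    by (intro bexI[of _ 0]) auto
qed

section \<open>Direct sums and biproducts\<close>

lemma vfst_vpair [simp]: "vfst (vpair v w) = v"
  and vsnd_vpair [simp]: "vsnd (vpair v w) = w"
  and vpair_collapse [simp]: "vpair (vfst u) (vsnd u) = u"
  and vfst_add [simp]: "vfst (u + u') = vfst u + vfst u'"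
  and vsnd_add [simp]: "vsnd (u + u') = vsnd u + vsnd u'"
  and vfst_scale [simp]: "vfst (\<lambda>i. c * u i) = (\<lambda>i. c * vfst u i)"
  and vsnd_scale [simp]: "vsnd (\<lambda>i. c * u i) = (\<lambda>i. c * vsnd u i)"
  and vfst_0 [simp]: "vfst 0 = 0"
  and vsnd_0 [simp]: "vsnd 0 = 0"
  and vpair_0 [simp]: "vpair 0 0 = 0"
  and vpair_add: "vpair v w + vpair v' w' = vpair (v + v') (w + w')"
  and vpair_scale: "(\<lambda>i. c * vpair v w i) = vpair (\<lambda>i. c * v i) (\<lambda>i. c * w i)"
  by (auto simp: vfst_def vsnd_def vpair_def fun_eq_iff)

lemma vpair_scale_zero:
  "(\<lambda>i. c * vpair v 0 i) = vpair (\<lambda>i. (c :: 'k::field) * v i) 0"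
  "(\<lambda>i. c * vpair 0 w i) = vpair 0 (\<lambda>i. (c :: 'k::field) * w i)"
  by (simp_all only: vpair_scale vec.scale_zero_right)

lemma pspace_dsum: "u \<in> pspace (dsum M N) p \<longleftrightarrow> vfst u \<in> pspace M p \<and> vsnd u \<in> pspace N p"
proof
  assume "vfst u \<in> pspace M p \<and> vsnd u \<in> pspace N p"
  moreover have "u = vpair (vfst u) (vsnd u)" by simp
  ultimately show "u \<in> pspace (dsum M N) p"
    unfolding dsum_def pmod.simps by blast
qed (auto simp: dsum_def)

lemma trans_map_dsum:
  "trans_map (dsum M N) p q u = vpair (trans_map M p q (vfst u)) (trans_map N p q (vsnd u))"
  by (simp add: dsum_def)

lemma trans_0:
  assumes "M \<in> pmods r" "(p, q) \<in> r" shows "trans_map M p q 0 = 0"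
  using trans_scale[OF assms pmods_0[OF assms(1) FieldI1[OF assms(2)]], of 0]
  by (simp only: vec.scale_zero_left)

lemma subspace_pspace: "M \<in> pmods r \<Longrightarrow> p \<in> Field r \<Longrightarrow> vec.subspace (pspace M p)"
  using pmods_fd[of M r p] by (simp add: fd_space_def)

text \<open>
  The direct sum is spanned by the images of two finite spanning sets.
\<close>

lemma fd_space_dsum:
  assumes M: "M \<in> pmods r" and N: "N \<in> pmods r" and p: "p \<in> Field r"
  shows "fd_space (pspace (dsum M N) p)"
proof -
  obtain B where B: "finite B" "vec.span B = pspace M p" using pmods_fd[OF M p] unfolding fd_space_def by blast
  obtain C where C: "finite C" "vec.span C = pspace N p" using pmods_fd[OF N p] unfolding fd_space_def by blast
  let ?D = "(\<lambda>v. vpair v 0) ` B \<union> (\<lambda>w. vpair 0 w) ` C"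
  have 1: "vpair v 0 \<in> vec.span ?D" if "v \<in> vec.span B" for v
    using that
  proof (induct rule: vec.span_induct_alt)
    case base
    then show ?case by (simp only: vpair_0 vec.span_zero)
  next
    case (step c x y)
    have "vpair ((\<lambda>i. c * x i) + y) 0 = (\<lambda>i. c * vpair x 0 i) + vpair y 0"
      by (simp only: vpair_scale vec.scale_zero_right vpair_add add_0_left)
    then show ?case using step by (metis UnI1 image_eqI vec.span_add vec.span_base vec.span_scale)
  qed
  have 2: "vpair 0 v \<in> vec.span ?D" if "v \<in> vec.span C" for v
    using that
  proof (induct rule: vec.span_induct_alt)
    case base
    then show ?case by (simp only: vpair_0 vec.span_zero)
  next
    case (step c x y)
    have "vpair 0 ((\<lambda>i. c * x i) + y) = (\<lambda>i. c * vpair 0 x i) + vpair 0 y"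
      by (simp only: vpair_scale vec.scale_zero_right vpair_add add_0_left)
    then show ?case using step by (metis UnI2 image_eqI vec.span_add vec.span_base vec.span_scale)
  qed
  have "u \<in> vec.span ?D" if "u \<in> pspace (dsum M N) p" for u
  proof -
    have "u = vpair (vfst u) 0 + vpair 0 (vsnd u)" by (simp add: vpair_add)
    then show ?thesis using 1[of "vfst u"] 2[of "vsnd u"] that B C
      by (metis pspace_dsum vec.span_add)
  qed
  moreover have "vec.subspace (pspace (dsum M N) p)"
    unfolding vec.subspace_def
    by (simp add: pspace_dsum pmods_0[OF M p] pmods_0[OF N p] pmods_add[OF M p] pmods_add[OF N p]
        pmods_scale[OF M p] pmods_scale[OF N p])
  ultimately show ?thesis using B C by (intro fd_spaceI[of _ ?D]) auto
qed

lemma dsum_pmods: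
  assumes M: "M \<in> pmods r" and N: "N \<in> pmods r" shows "dsum M N \<in> pmods r"
proof (rule pmodsI)
  show "fd_space (pspace (dsum M N) p)" if "p \<in> Field r" for p
    using fd_space_dsum[OF M N that] .
qed (simp_all add: pspace_dsum trans_map_dsum trans_in[OF M] trans_in[OF N] trans_add[OF M] trans_add[OF N]
  vpair_add vpair_scale trans_scale[OF M] trans_scale[OF N] trans_id[OF M] trans_id[OF N]
  trans_comp[OF M] trans_comp[OF N])

text \<open>
  The five equations that characterise a direct sum. They are invariant under isomorphism and
  free of coordinates, unlike \<^const>\<open>dsum\<close>; whatever is known about direct sums of modules is
  derived from them.
\<close>

definition biproduct :: "'p rel \<Rightarrow> ('p, 'k::field) pmod \<Rightarrow> ('p, 'k) pmod \<Rightarrow> ('p, 'k) pmod \<Rightarrow> bool" where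
  "biproduct r L M N \<longleftrightarrow> (\<exists>i1\<in>Hom r M L. \<exists>i2\<in>Hom r N L. \<exists>p1\<in>Hom r L M. \<exists>p2\<in>Hom r L N.
     p1 \<bullet> i1 = hid r M \<and> p2 \<bullet> i2 = hid r N \<and> p1 \<bullet> i2 = 0 \<and> p2 \<bullet> i1 = 0 \<and>
     i1 \<bullet> p1 + i2 \<bullet> p2 = hid r L)"

lemma biproduct_dsum:
  assumes M: "M \<in> pmods r" and N: "N \<in> pmods r"
  shows "biproduct r (dsum M N) M N"
proof -
  define i1 where "i1 = (\<lambda>p v. if p \<in> Field r \<and> v \<in> pspace M p then vpair v 0 else 0)"
  define i2 where "i2 = (\<lambda>p v. if p \<in> Field r \<and> v \<in> pspace N p then vpair 0 v else 0)"
  define p1 where "p1 = (\<lambda>p u. if p \<in> Field r \<and> u \<in> pspace (dsum M N) p then vfst u else 0)"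
  define p2 where "p2 = (\<lambda>p u. if p \<in> Field r \<and> u \<in> pspace (dsum M N) p then vsnd u else 0)"
  note defs = i1_def i2_def p1_def p2_def
  note sim = pspace_dsum trans_map_dsum vpair_add
    pmods_0[OF M] pmods_add[OF M] pmods_scale[OF M] trans_in[OF M] trans_0[OF M]
    pmods_0[OF N] pmods_add[OF N] pmods_scale[OF N] trans_in[OF N] trans_0[OF N]
  have "i1 \<in> Hom r M (dsum M N)"
    by (rule HomI) (auto simp: sim i1_def vpair_scale_zero)
  moreover have "i2 \<in> Hom r N (dsum M N)"
    by (rule HomI) (auto simp: sim i2_def vpair_scale_zero)
  moreover have "p1 \<in> Hom r (dsum M N) M"
    by (rule HomI) (auto simp: sim p1_def vpair_scale)
  moreover have "p2 \<in> Hom r (dsum M N) N"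
    by (rule HomI) (auto simp: sim p2_def vpair_scale)
  moreover have "p1 \<bullet> i1 = hid r M" "p2 \<bullet> i2 = hid r N" "p1 \<bullet> i2 = 0" "p2 \<bullet> i1 = 0"
    unfolding hcomp_def hid_def by (rule ext, rule ext, simp add: defs sim)+
  moreover have "i1 \<bullet> p1 + i2 \<bullet> p2 = hid r (dsum M N)"
    unfolding hcomp_def hid_def by (rule ext, rule ext, simp add: defs sim)
  ultimately show ?thesis unfolding biproduct_def by blast
qed

lemma biproduct_swap: "biproduct r L M N \<Longrightarrow> biproduct r L N M"
  unfolding biproduct_def
  by (elim bexE conjE, rule bexI, rule bexI, rule bexI, rule bexI) (auto simp: add.commute)

lemma biproduct_unique:
  assumes "biproduct r L M N" "biproduct r L' M N" "L \<in> pmods r" "L' \<in> pmods r"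
  shows "pmod_iso r L L'"
proof -
  obtain i1 i2 p1 p2 where 1: "i1 \<in> Hom r M L" "i2 \<in> Hom r N L" "p1 \<in> Hom r L M" "p2 \<in> Hom r L N"
    "p1 \<bullet> i1 = hid r M" "p2 \<bullet> i2 = hid r N" "p1 \<bullet> i2 = 0" "p2 \<bullet> i1 = 0" "i1 \<bullet> p1 + i2 \<bullet> p2 = hid r L"
    using assms(1) unfolding biproduct_def by blast
  obtain j1 j2 q1 q2 where 2: "j1 \<in> Hom r M L'" "j2 \<in> Hom r N L'" "q1 \<in> Hom r L' M" "q2 \<in> Hom r L' N"
    "q1 \<bullet> j1 = hid r M" "q2 \<bullet> j2 = hid r N" "q1 \<bullet> j2 = 0" "q2 \<bullet> j1 = 0" "j1 \<bullet> q1 + j2 \<bullet> q2 = hid r L'"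
    using assms(2) unfolding biproduct_def by blast
  have *: "(i1 \<bullet> q1 + i2 \<bullet> q2) \<bullet> (j1 \<bullet> p1 + j2 \<bullet> p2) = hid r L"
    if i: "i1 \<in> Hom r M L" "i2 \<in> Hom r N L" "p1 \<in> Hom r L M" "p2 \<in> Hom r L N" "i1 \<bullet> p1 + i2 \<bullet> p2 = hid r L"
      and j: "j1 \<in> Hom r M L'" "j2 \<in> Hom r N L'" "q1 \<in> Hom r L' M" "q2 \<in> Hom r L' N"
      "q1 \<bullet> j1 = hid r M" "q2 \<bullet> j2 = hid r N" "q1 \<bullet> j2 = 0" "q2 \<bullet> j1 = 0"
    for i1 i2 p1 p2 j1 j2 q1 q2 L L'
  proof -
    note A = hcomp_Hom[OF j(1) i(3)] hcomp_Hom[OF j(2) i(4)]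
    have "q1 \<bullet> (j1 \<bullet> p1 + j2 \<bullet> p2) = p1"
      unfolding hcomp_add_right[OF j(3) A] hcomp_assoc[symmetric] j(5,7)
      by (simp add: hcomp_hid_left[OF i(3)])
    moreover have "q2 \<bullet> (j1 \<bullet> p1 + j2 \<bullet> p2) = p2"
      unfolding hcomp_add_right[OF j(4) A] hcomp_assoc[symmetric] j(6,8)
      by (simp add: hcomp_hid_left[OF i(4)])
    ultimately show ?thesis using i(5) by (simp add: hcomp_add_left hcomp_assoc)
  qed
  have "j1 \<bullet> p1 + j2 \<bullet> p2 \<in> Hom r L L'" "i1 \<bullet> q1 + i2 \<bullet> q2 \<in> Hom r L' L"
    using 1 2 assms by (simp_all add: Hom_plus hcomp_Hom)
  then show ?thesis unfolding pmod_iso_iff using *[OF 1(1-4,9) 2(1-8)] *[OF 2(1-4,9) 1(1-8)] by blast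
qed

lemma biproduct_cong:
  assumes "biproduct r L M N" "pmod_iso r M M'" "pmod_iso r N N'"
  shows "biproduct r L M' N'"
proof -
  obtain i1 i2 p1 p2 where 1: "i1 \<in> Hom r M L" "i2 \<in> Hom r N L" "p1 \<in> Hom r L M" "p2 \<in> Hom r L N"
    "p1 \<bullet> i1 = hid r M" "p2 \<bullet> i2 = hid r N" "p1 \<bullet> i2 = 0" "p2 \<bullet> i1 = 0" "i1 \<bullet> p1 + i2 \<bullet> p2 = hid r L"
    using assms(1) unfolding biproduct_def by blast
  obtain g h where g: "g \<in> Hom r M M'" "h \<in> Hom r M' M" "h \<bullet> g = hid r M" "g \<bullet> h = hid r M'"
    using assms(2) unfolding pmod_iso_iff by blast
  obtain g' h' where g': "g' \<in> Hom r N N'" "h' \<in> Hom r N' N" "h' \<bullet> g' = hid r N" "g' \<bullet> h' = hid r N'"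
    using assms(3) unfolding pmod_iso_iff by blast
  have eq: "a \<bullet> b \<bullet> (c \<bullet> d) = a \<bullet> (b \<bullet> c) \<bullet> d" for a b c d :: "'a \<Rightarrow> 'b vec \<Rightarrow> 'b vec"
    by (simp add: hcomp_assoc)
  have "(g \<bullet> p1) \<bullet> (i1 \<bullet> h) = hid r M'" "(g' \<bullet> p2) \<bullet> (i2 \<bullet> h') = hid r N'"
    "(g \<bullet> p1) \<bullet> (i2 \<bullet> h') = 0" "(g' \<bullet> p2) \<bullet> (i1 \<bullet> h) = 0"
    "(i1 \<bullet> h) \<bullet> (g \<bullet> p1) + (i2 \<bullet> h') \<bullet> (g' \<bullet> p2) = hid r L"
    unfolding eq 1 g g' hcomp_hid_right[OF 1(1)] hcomp_hid_right[OF 1(2)]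
      hcomp_hid_right[OF g(1)] hcomp_hid_right[OF g'(1)] hcomp_0_right[OF g(1)] hcomp_0_right[OF g'(1)]
    by (simp_all add: 1 g g')
  then show ?thesis unfolding biproduct_def
    using hcomp_Hom[OF 1(1) g(2)] hcomp_Hom[OF 1(2) g'(2)] hcomp_Hom[OF g(1) 1(3)] hcomp_Hom[OF g'(1) 1(4)]
    by blast
qed

lemma biproduct_iso_dsum:
  assumes "L \<in> pmods r" "M \<in> pmods r" "N \<in> pmods r" "biproduct r L M N"
  shows "pmod_iso r L (dsum M N)"
  using biproduct_unique[OF assms(4) biproduct_dsum[OF assms(2,3)] assms(1) dsum_pmods[OF assms(2,3)]] .

text \<open>
  An isomorphism is a biproduct with zero, so that invariance of an additive quantity under
  isomorphism is a special case of its additivity.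
\<close>

lemma biproduct_zero:
  assumes "pmod_iso r L M" "L \<in> pmods r" "M \<in> pmods r"
  shows "biproduct r L M zero_pmod"
proof -
  obtain g h where g: "g \<in> Hom r L M" "h \<in> Hom r M L" "h \<bullet> g = hid r L" "g \<bullet> h = hid r M"
    using assms(1) unfolding pmod_iso_iff by blast
  have "hid r zero_pmod = (0 :: 'a \<Rightarrow> 'b vec \<Rightarrow> 'b vec)"
    using Hom_to_zero[OF hid_Hom[OF zero_pmod]] .
  then show ?thesis unfolding biproduct_def
    using g Hom_zero_in[OF zero_pmod] Hom_zero_in[OF assms(2)] hcomp_0_right[OF g(1)]
    by (intro bexI[of _ h] bexI[of _ 0] bexI[of _ g] conjI) auto
qed

lemma dsum_cong:
  assumes "M \<in> pmods r" "N \<in> pmods r" "M' \<in> pmods r" "N' \<in> pmods r" "pmod_iso r M M'" "pmod_iso r N N'"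
  shows "pmod_iso r (dsum M N) (dsum M' N')"
  using biproduct_iso_dsum[OF dsum_pmods[OF assms(1,2)] assms(3,4)
    biproduct_cong[OF biproduct_dsum[OF assms(1,2)] assms(5,6)]] .

lemma dsum_comm:
  assumes "M \<in> pmods r" "N \<in> pmods r"
  shows "pmod_iso r (dsum M N) (dsum N M)"
  using biproduct_iso_dsum[OF dsum_pmods[OF assms] assms(2,1) biproduct_swap[OF biproduct_dsum[OF assms]]] .

lemma dsum_zero_right:
  assumes "M \<in> pmods r" shows "pmod_iso r M (dsum M zero_pmod)"
  using biproduct_iso_dsum[OF assms assms zero_pmod biproduct_zero[OF pmod_iso_refl[OF assms] assms assms]] .

lemma dsum_zero_left:
  assumes "M \<in> pmods r" shows "pmod_iso r M (dsum zero_pmod M)"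
  using pmod_iso_trans[OF dsum_zero_right[OF assms] dsum_comm[OF assms zero_pmod]] .

text \<open>
  Here coordinates are more convenient: the isomorphism only regroups the three components.
\<close>

lemma dsum_assoc:
  assumes L: "L \<in> pmods r" and M: "M \<in> pmods r" and N: "N \<in> pmods r"
  shows "pmod_iso r (dsum (dsum L M) N) (dsum L (dsum M N))"
proof -
  define g where "g = (\<lambda>p u. if p \<in> Field r \<and> u \<in> pspace (dsum (dsum L M) N) p
    then vpair (vfst (vfst u)) (vpair (vsnd (vfst u)) (vsnd u)) else 0)"
  define h where "h = (\<lambda>p u. if p \<in> Field r \<and> u \<in> pspace (dsum L (dsum M N)) p
    then vpair (vpair (vfst u) (vfst (vsnd u))) (vsnd (vsnd u)) else 0)"
  note sim = pspace_dsum trans_map_dsum vpair_add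
    pmods_0[OF L] pmods_add[OF L] pmods_scale[OF L] trans_in[OF L]
    pmods_0[OF M] pmods_add[OF M] pmods_scale[OF M] trans_in[OF M]
    pmods_0[OF N] pmods_add[OF N] pmods_scale[OF N] trans_in[OF N]
  have "g \<in> Hom r (dsum (dsum L M) N) (dsum L (dsum M N))"
    by (rule HomI) (auto simp: sim g_def vpair_scale)
  moreover have "h \<in> Hom r (dsum L (dsum M N)) (dsum (dsum L M) N)"
    by (rule HomI) (auto simp: sim h_def vpair_scale)
  moreover have "\<forall>p\<in>Field r. (\<forall>v\<in>pspace (dsum (dsum L M) N) p. h p (g p v) = v) \<and>
      (\<forall>v\<in>pspace (dsum L (dsum M N)) p. g p (h p v) = v)"
    by (auto simp: sim g_def h_def)
  ultimately show ?thesis unfolding pmod_iso_def by blast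
qed

section \<open>Splitting idempotents\<close>

lemma fd_space_subspace:
  assumes "fd_space V" "vec.subspace W" "W \<subseteq> V" shows "fd_space W"
proof -
  obtain B where "finite B" "vec.span B = V" using assms(1) unfolding fd_space_def by blast
  with assms show ?thesis by (intro fd_spaceI[of W B]) auto
qed

text \<open>
  The image of an idempotent is its module of fixed vectors.
\<close>

lemma idempotent_splits:
  assumes M: "M \<in> pmods r" and e: "e \<in> Hom r M M" "e \<bullet> e = e"
  obtains S \<iota> \<rho> where "S \<in> pmods r" "\<iota> \<in> Hom r S M" "\<rho> \<in> Hom r M S" "\<rho> \<bullet> \<iota> = hid r S" "\<iota> \<bullet> \<rho> = e"
proof -
  define S where "S = \<lparr>pspace = (\<lambda>p. {v \<in> pspace M p. e p v = v}), trans_map = trans_map M\<rparr>"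
  have S: "v \<in> pspace S p \<longleftrightarrow> v \<in> pspace M p \<and> e p v = v" "trans_map S = trans_map M" for p v
    by (auto simp: S_def)
  have ee: "e p (e p v) = e p v" for p v
    using fun_cong[OF fun_cong[OF e(2)], of p v] by (simp add: hcomp_def)
  have Spm: "S \<in> pmods r"
  proof (rule pmodsI)
    fix p assume p: "p \<in> Field r"
    have "vec.subspace (pspace S p)"
      unfolding vec.subspace_def S
      by (auto simp: S pmods_0[OF M p] pmods_add[OF M p] pmods_scale[OF M p] Hom_0[OF e(1)]
          Hom_add[OF e(1) p] Hom_scale[OF e(1) p])
    then show "fd_space (pspace S p)"
      by (rule fd_space_subspace[OF pmods_fd[OF M p]]) (auto simp: S)
  qed (simp_all add: S trans_in[OF M] Hom_natural[OF e(1)] trans_add[OF M] trans_scale[OF M]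
      trans_id[OF M] trans_comp[OF M])
  define \<iota> where "\<iota> = (\<lambda>p v. if p \<in> Field r \<and> v \<in> pspace S p then v else 0)"
  have "\<iota> \<in> Hom r S M"
    by (rule HomI) (auto simp: \<iota>_def pmods_add[OF Spm] pmods_scale[OF Spm] trans_in[OF Spm], auto simp: S)
  moreover have "e \<in> Hom r M S"
    by (rule HomI) (simp_all add: S ee Hom_in[OF e(1)] Hom_add[OF e(1)] Hom_scale[OF e(1)]
        Hom_natural[OF e(1)] Hom_outside[OF e(1)])
  moreover have "e \<bullet> \<iota> = hid r S"
    unfolding hcomp_def hid_def by (rule ext, rule ext, simp add: \<iota>_def S Hom_0[OF e(1)])
  moreover have "\<iota> p (e p v) = e p v" for p v
    using Hom_in[OF e(1), of p v] Hom_outside[OF e(1), of p v]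
    by (cases "p \<in> Field r \<and> v \<in> pspace M p") (auto simp: \<iota>_def S ee)
  then have "\<iota> \<bullet> e = e" unfolding hcomp_def by (intro ext) simp
  ultimately show thesis using that Spm by blast
qed

text \<open>
  An idempotent and its complement split \<^term>\<open>M\<close> as a direct sum of their images, one of
  which must be zero.
\<close>

lemma indecomposable_idempotent:
  assumes M: "M \<in> indecomposables r" and e: "e \<in> Hom r M M" "e \<bullet> e = e"
  shows "e = 0 \<or> e = hid r M"
proof -
  have Mp: "M \<in> pmods r" using M by (simp add: indecomposables_def)
  let ?f = "hid r M - e"
  note id = hid_Hom[OF Mp]
  have f: "?f \<in> Hom r M M" using Hom_minus[OF Mp id e(1)] .
  have ef: "e \<bullet> ?f = 0" "?f \<bullet> e = 0"
    using hcomp_diff_right[OF Mp e(1) id e(1)] hcomp_hid_right[OF e(1)] hcomp_hid_left[OF e(1)] e(2)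
    by (simp_all add: hcomp_diff_left)
  have ff: "?f \<bullet> ?f = ?f"
    using hcomp_diff_right[OF Mp f id e(1)] hcomp_hid_right[OF f] ef by simp
  obtain S i p where S: "S \<in> pmods r" "i \<in> Hom r S M" "p \<in> Hom r M S" "p \<bullet> i = hid r S" "i \<bullet> p = e"
    using idempotent_splits[OF Mp e] .
  obtain S' i' p' where S': "S' \<in> pmods r" "i' \<in> Hom r S' M" "p' \<in> Hom r M S'" "p' \<bullet> i' = hid r S'" "i' \<bullet> p' = ?f"
    using idempotent_splits[OF Mp f ff] .
  have "p \<bullet> i' = p \<bullet> (i \<bullet> p \<bullet> (i' \<bullet> p')) \<bullet> i'"
    using S(4) S'(4) hcomp_hid_left[OF S(3)] hcomp_hid_right[OF S'(2)]
    by (metis hcomp_assoc)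
  then have pi': "p \<bullet> i' = 0" using S S' ef hcomp_0_right[OF S(3)] by simp
  have "p' \<bullet> i = p' \<bullet> (i' \<bullet> p' \<bullet> (i \<bullet> p)) \<bullet> i"
    using S(4) S'(4) hcomp_hid_left[OF S'(3)] hcomp_hid_right[OF S(2)]
    by (metis hcomp_assoc)
  then have p'i: "p' \<bullet> i = 0" using S S' ef hcomp_0_right[OF S'(3)] by simp
  have "biproduct r M S S'"
    unfolding biproduct_def using S S' pi' p'i by (intro bexI conjI) simp_all
  then have "pmod_iso r M (dsum S S')" using biproduct_iso_dsum Mp S(1) S'(1) by blast
  then have "hid r S = 0 \<or> hid r S' = 0"
    using M S(1) S'(1) pmod_iso_zero_iff[OF S(1)] pmod_iso_zero_iff[OF S'(1)]
    by (auto simp: indecomposables_def)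
  then show ?thesis
  proof
    assume "hid r S = 0"
    then have "e = 0" using S(5) hcomp_hid_left[OF S(3)] hcomp_0_right[OF S(2)] by simp
    then show ?thesis ..
  next
    assume "hid r S' = 0"
    then have "?f = 0" using S'(5) hcomp_hid_left[OF S'(3)] hcomp_0_right[OF S'(2)] by simp
    then show ?thesis by simp
  qed
qed

section \<open>Dimensions of spaces of homomorphisms\<close>

lemma sum_apply_nested: "(\<Sum>a\<in>A. f a) q v i = (\<Sum>a\<in>A. f a q v i)"
  for f :: "'a \<Rightarrow> 'p \<Rightarrow> 'k vec \<Rightarrow> 'k::field vec"
  by (induct A rule: infinite_finite_induct) auto

lemma Hom_sum:
  assumes h: "h \<in> Hom r M N" and M: "M \<in> pmods r" and p: "p \<in> Field r"
    and B: "finite B" "B \<subseteq> pspace M p"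
  shows "h p (\<Sum>b\<in>B. (\<lambda>i. c b * b i)) i = (\<Sum>b\<in>B. c b * h p b i)"
proof -
  define t where "t b = (\<lambda>i. c b * b i)" for b
  have "h p (sum t B) i = (\<Sum>b\<in>B. c b * h p b i) \<and> sum t B \<in> pspace M p"
    using B
  proof (induct B)
    case empty
    show "h p (sum t {}) i = (\<Sum>b\<in>{}. c b * h p b i) \<and> sum t {} \<in> pspace M p"
      by (simp add: Hom_0[OF h] pmods_0[OF M p])
  next
    case (insert b B)
    have t: "t b \<in> pspace M p" "h p (t b) = (\<lambda>i. c b * h p b i)"
      unfolding t_def using pmods_scale[OF M p, of b] Hom_scale[OF h p, of b] insert by simp_all
    have "sum t B \<in> pspace M p" "h p (sum t B) i = (\<Sum>b\<in>B. c b * h p b i)"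
      using insert by simp_all
    then show "h p (sum t (insert b B)) i = (\<Sum>b\<in>insert b B. c b * h p b i) \<and>
        sum t (insert b B) \<in> pspace M p"
      using insert(1,2) t by (simp add: Hom_add[OF h p] pmods_add[OF M p])
  qed
  then show ?thesis unfolding t_def by blast
qed

text \<open>
  A homomorphism is determined by the images of the vectors of chosen finite bases. Hence it is a
  linear combination of the finitely many families of maps that send one basis vector to one
  element of a spanning set. Such a family is
  rarely natural itself, which is why the span is taken in the space of all families.
\<close>

lemma Hom_finite_dim:
  assumes r: "finite r" and M: "M \<in> pmods r" and N: "N \<in> pmods r"
  obtains B where "finite B" "Hom r M N \<subseteq> nat_trans.span B"
proof -
  have "\<exists>B. finite B \<and> vec.independent B \<and> vec.span B = pspace M p" if p: "p \<in> Field r" for p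
  proof -
    obtain A where A: "finite A" "vec.span A = pspace M p" using pmods_fd[OF M p] unfolding fd_space_def by blast
    obtain B where "B \<subseteq> pspace M p" "vec.independent B" "finite B" "pspace M p \<subseteq> vec.span B"
      "card B = vec.dim (pspace M p)"
      using vec.finite_basis_exists[OF eq_refl[OF A(2)[symmetric]] A(1)] .
    then show ?thesis using vec.span_minimal[OF _ subspace_pspace[OF M p], of B] by auto
  qed
  then obtain B where B: "\<And>p. p \<in> Field r \<Longrightarrow> finite (B p) \<and> vec.independent (B p) \<and> vec.span (B p) = pspace M p"
    by metis
  have "\<forall>p\<in>Field r. \<exists>C. finite C \<and> vec.span C = pspace N p"
    using pmods_fd[OF N] unfolding fd_space_def by blast
  then obtain C where C: "\<And>p. p \<in> Field r \<Longrightarrow> finite (C p) \<and> vec.span (C p) = pspace N p"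
    by metis
  \<comment> \<open>\<open>D p b w\<close> sends the basis vector \<open>b\<close> at \<open>p\<close> to \<open>w\<close> and everything else to zero.\<close>
  define D where "D = (\<lambda>p b (w :: 'b vec) q v i.
    if q = p \<and> v \<in> pspace M p then vec.representation (B p) v b * w i else 0)"
  define G where "G = (\<Union>p\<in>Field r. \<Union>b\<in>B p. D p b ` C p)"
  have finF: "finite (Field r)" using r by (simp add: finite_Field)
  have finG: "finite G" using finF B C by (auto simp: G_def)
  have D: "D p b w \<in> nat_trans.span G" if "p \<in> Field r" "b \<in> B p" "w \<in> pspace N p" for p b w
  proof -
    have "w \<in> vec.span (C p)" using C that by simp
    then show ?thesis
    proof (induct rule: vec.span_induct_alt)
      case base
      have "D p b 0 = 0" by (auto simp: D_def fun_eq_iff)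
      then show "D p b 0 \<in> nat_trans.span G" by (simp add: nat_trans.span_zero)
    next
      case (step c x y)
      have "D p b x \<in> G" using step(1) that by (auto simp: G_def)
      then have 1: "D p b x \<in> nat_trans.span G" by (rule nat_trans.span_base)
      have "D p b ((\<lambda>i. c * x i) + y) = (\<lambda>q v i. c * D p b x q v i) + D p b y"
        by (auto simp: D_def fun_eq_iff algebra_simps)
      then show "D p b ((\<lambda>i. c * x i) + y) \<in> nat_trans.span G"
        using nat_trans.span_add[OF nat_trans.span_scale[OF 1] step(2)] by simp
    qed
  qed
  have "h \<in> nat_trans.span G" if h: "h \<in> Hom r M N" for h
  proof -
    have "h = (\<Sum>p\<in>Field r. \<Sum>b\<in>B p. D p b (h p b))"
    proof (rule ext, rule ext, rule ext)
      fix q v i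
      show "h q v i = (\<Sum>p\<in>Field r. \<Sum>b\<in>B p. D p b (h p b)) q v i"
      proof (cases "q \<in> Field r \<and> v \<in> pspace M q")
        case False
        then have "D p b (h p b) q v i = 0" if "p \<in> Field r" for p b
          using that by (auto simp: D_def)
        then show ?thesis unfolding sum_apply_nested Hom_outside[OF h False] by simp
      next
        case True
        have Bq: "B q \<subseteq> pspace M q" using B True vec.span_superset[of "B q"] by auto
        have v: "(\<Sum>b\<in>B q. (\<lambda>i. vec.representation (B q) v b * b i)) = v"
          using B True by (intro vec.sum_representation_eq) auto
        have "(\<Sum>p\<in>Field r. \<Sum>b\<in>B p. D p b (h p b)) q v i
            = (\<Sum>p\<in>Field r. if p = q then \<Sum>b\<in>B q. vec.representation (B q) v b * h q b i else 0)"
          unfolding sum_apply_nested using True by (intro sum.cong) (auto simp: D_def)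
        also have "\<dots> = (\<Sum>b\<in>B q. vec.representation (B q) v b * h q b i)"
          using True finF by simp
        also have "\<dots> = h q v i"
          using Hom_sum[OF h M conjunct1[OF True] _ Bq, of "vec.representation (B q) v" i] B True
          unfolding v by simp
        finally show ?thesis by simp
      qed
    qed
    moreover have "\<dots> \<in> nat_trans.span G"
    proof (intro nat_trans.span_sum D)
      fix p b assume p: "p \<in> Field r" and b: "b \<in> B p"
      then have "b \<in> pspace M p" using B vec.span_base by blast
      then show "h p b \<in> pspace N p" by (rule Hom_in[OF h p])
    qed
    ultimately show ?thesis by simp
  qed
  then show thesis using that finG by blast
qed

lemma dim_Hom_precomp:
  assumes r: "finite r" and E: "E \<in> pmods r" and M: "M \<in> pmods r"
  shows "dim_Hom r E M = nat_trans.dim {h \<in> Hom r E M. h \<bullet> u = 0} + nat_trans.dim ((\<lambda>h. h \<bullet> u) ` Hom r E M)"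
proof -
  obtain B where B: "finite B" "Hom r E M \<subseteq> nat_trans.span B" using Hom_finite_dim[OF assms] .
  show ?thesis unfolding dim_Hom_def
    by (rule nat_trans.dim_kernel_image[OF subspace_Hom[OF M] B(2,1)])
      (simp_all add: hcomp_add_left hcomp_scale_left)
qed

lemma dim_Hom_postcomp:
  assumes r: "finite r" and L: "L \<in> pmods r" and M: "M \<in> pmods r" and u: "u \<in> Hom r M N"
  shows "dim_Hom r L M = nat_trans.dim {h \<in> Hom r L M. u \<bullet> h = 0} + nat_trans.dim ((\<lambda>h. u \<bullet> h) ` Hom r L M)"
proof -
  obtain B where B: "finite B" "Hom r L M \<subseteq> nat_trans.span B" using Hom_finite_dim[OF assms(1-3)] .
  show ?thesis unfolding dim_Hom_def
    by (rule nat_trans.dim_kernel_image[OF subspace_Hom[OF M] B(2,1)])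
      (simp_all add: hcomp_add_right[OF u] hcomp_scale_right[OF u])
qed

lemma dim_precomp_epi:
  assumes r: "finite r" and E: "E \<in> pmods r" and M: "M \<in> pmods r"
    and "\<And>h. h \<in> Hom r E M \<Longrightarrow> h \<bullet> u = 0 \<Longrightarrow> h = 0"
  shows "nat_trans.dim ((\<lambda>h. h \<bullet> u) ` Hom r E M) = dim_Hom r E M"
proof -
  have "{h \<in> Hom r E M. h \<bullet> u = 0} = {0}" using assms(4) Hom_zero_in[OF M] by auto
  then show ?thesis using dim_Hom_precomp[OF assms(1-3), of u] by simp
qed

lemma dim_postcomp_mono:
  assumes r: "finite r" and L: "L \<in> pmods r" and M: "M \<in> pmods r" and u: "u \<in> Hom r M N"
    and "\<And>h. h \<in> Hom r L M \<Longrightarrow> u \<bullet> h = 0 \<Longrightarrow> h = 0"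
  shows "nat_trans.dim ((\<lambda>h. u \<bullet> h) ` Hom r L M) = dim_Hom r L M"
proof -
  have "{h \<in> Hom r L M. u \<bullet> h = 0} = {0}" using assms(5) Hom_zero_in[OF M] hcomp_0_right[OF u] by auto
  then show ?thesis using dim_Hom_postcomp[OF assms(1-4)] by simp
qed

text \<open>
  Restriction to \<^term>\<open>M\<close> maps the homomorphisms on \<^term>\<open>L\<close> onto those on \<^term>\<open>M\<close>, and
  its kernel consists of the homomorphisms that come from \<^term>\<open>N\<close>.
\<close>

lemma dim_Hom_biproduct_left:
  assumes r: "finite r" and pm: "L \<in> pmods r" "M \<in> pmods r" "N \<in> pmods r" "A \<in> pmods r"
    and bi: "biproduct r L M N"
  shows "dim_Hom r L A = dim_Hom r M A + dim_Hom r N A"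
proof -
  obtain i1 i2 p1 p2 where b: "i1 \<in> Hom r M L" "i2 \<in> Hom r N L" "p1 \<in> Hom r L M" "p2 \<in> Hom r L N"
    "p1 \<bullet> i1 = hid r M" "p2 \<bullet> i2 = hid r N" "p1 \<bullet> i2 = 0" "p2 \<bullet> i1 = 0" "i1 \<bullet> p1 + i2 \<bullet> p2 = hid r L"
    using bi unfolding biproduct_def by blast
  have "(\<lambda>h. h \<bullet> i1) ` Hom r L A = Hom r M A"
  proof (intro equalityI subsetI)
    fix k assume k: "k \<in> Hom r M A"
    have "k = (k \<bullet> p1) \<bullet> i1" using hcomp_hid_right[OF k] b(5) by (simp add: hcomp_assoc)
    then show "k \<in> (\<lambda>h. h \<bullet> i1) ` Hom r L A" using hcomp_Hom[OF k b(3)] by blast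
  qed (use hcomp_Hom[OF _ b(1)] in auto)
  moreover have "{h \<in> Hom r L A. h \<bullet> i1 = 0} = (\<lambda>k. k \<bullet> p2) ` Hom r N A"
  proof (intro equalityI subsetI)
    fix h assume "h \<in> {h \<in> Hom r L A. h \<bullet> i1 = 0}"
    then have h: "h \<in> Hom r L A" "h \<bullet> i1 = 0" by auto
    have "h = h \<bullet> (i1 \<bullet> p1 + i2 \<bullet> p2)" using hcomp_hid_right[OF h(1)] b(9) by simp
    also have "\<dots> = (h \<bullet> i2) \<bullet> p2"
      unfolding hcomp_add_right[OF h(1) hcomp_Hom[OF b(1,3)] hcomp_Hom[OF b(2,4)]] hcomp_assoc[symmetric] h(2)
      by simp
    finally show "h \<in> (\<lambda>k. k \<bullet> p2) ` Hom r N A" using hcomp_Hom[OF h(1) b(2)] by blast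
  next
    fix h assume "h \<in> (\<lambda>k. k \<bullet> p2) ` Hom r N A"
    then obtain k where k: "k \<in> Hom r N A" "h = k \<bullet> p2" by blast
    then show "h \<in> {h \<in> Hom r L A. h \<bullet> i1 = 0}"
      using hcomp_Hom[OF k(1) b(4)] hcomp_0_right[OF k(1)] b(8) by (simp add: hcomp_assoc)
  qed
  moreover have "nat_trans.dim ((\<lambda>k. k \<bullet> p2) ` Hom r N A) = dim_Hom r N A"
  proof (rule dim_precomp_epi[OF r pm(3,4)])
    fix k assume k: "k \<in> Hom r N A" "k \<bullet> p2 = 0"
    have "k = (k \<bullet> p2) \<bullet> i2" using hcomp_hid_right[OF k(1)] b(6) by (simp add: hcomp_assoc)
    then show "k = 0" using k by simp
  qed
  ultimately show ?thesis using dim_Hom_precomp[OF r pm(1,4), of i1] by (simp add: dim_Hom_def)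
qed

lemma dim_Hom_biproduct_right:
  assumes r: "finite r" and pm: "L \<in> pmods r" "M \<in> pmods r" "N \<in> pmods r" "A \<in> pmods r"
    and bi: "biproduct r L M N"
  shows "dim_Hom r A L = dim_Hom r A M + dim_Hom r A N"
proof -
  obtain i1 i2 p1 p2 where b: "i1 \<in> Hom r M L" "i2 \<in> Hom r N L" "p1 \<in> Hom r L M" "p2 \<in> Hom r L N"
    "p1 \<bullet> i1 = hid r M" "p2 \<bullet> i2 = hid r N" "p1 \<bullet> i2 = 0" "p2 \<bullet> i1 = 0" "i1 \<bullet> p1 + i2 \<bullet> p2 = hid r L"
    using bi unfolding biproduct_def by blast
  have "(\<lambda>h. p1 \<bullet> h) ` Hom r A L = Hom r A M"
  proof (intro equalityI subsetI)
    fix k assume k: "k \<in> Hom r A M"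
    have "k = p1 \<bullet> (i1 \<bullet> k)" using hcomp_hid_left[OF k] b(5) by (simp add: hcomp_assoc[symmetric])
    then show "k \<in> (\<lambda>h. p1 \<bullet> h) ` Hom r A L" using hcomp_Hom[OF b(1) k] by blast
  qed (use hcomp_Hom[OF b(3)] in auto)
  moreover have "{h \<in> Hom r A L. p1 \<bullet> h = 0} = (\<lambda>k. i2 \<bullet> k) ` Hom r A N"
  proof (intro equalityI subsetI)
    fix h assume "h \<in> {h \<in> Hom r A L. p1 \<bullet> h = 0}"
    then have h: "h \<in> Hom r A L" "p1 \<bullet> h = 0" by auto
    have "h = (i1 \<bullet> p1 + i2 \<bullet> p2) \<bullet> h" using hcomp_hid_left[OF h(1)] b(9) by simp
    also have "\<dots> = i2 \<bullet> (p2 \<bullet> h)"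
      unfolding hcomp_add_left hcomp_assoc h(2) hcomp_0_right[OF b(1)] by simp
    finally show "h \<in> (\<lambda>k. i2 \<bullet> k) ` Hom r A N" using hcomp_Hom[OF b(4) h(1)] by blast
  next
    fix h assume "h \<in> (\<lambda>k. i2 \<bullet> k) ` Hom r A N"
    then obtain k where k: "k \<in> Hom r A N" "h = i2 \<bullet> k" by blast
    then show "h \<in> {h \<in> Hom r A L. p1 \<bullet> h = 0}"
      using hcomp_Hom[OF b(2) k(1)] b(7) by (simp add: hcomp_assoc[symmetric])
  qed
  moreover have "nat_trans.dim ((\<lambda>k. i2 \<bullet> k) ` Hom r A N) = dim_Hom r A N"
  proof (rule dim_postcomp_mono[OF r pm(4,3) b(2)])
    fix k assume k: "k \<in> Hom r A N" "i2 \<bullet> k = 0"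
    have "k = p2 \<bullet> (i2 \<bullet> k)" using hcomp_hid_left[OF k(1)] b(6) by (simp add: hcomp_assoc[symmetric])
    then show "k = 0" using k hcomp_0_right[OF b(4)] by simp
  qed
  ultimately show ?thesis using dim_Hom_postcomp[OF r pm(4,1) b(3)] by (simp add: dim_Hom_def)
qed

lemma dim_Hom_zero_left: "M \<in> pmods r \<Longrightarrow> dim_Hom r zero_pmod M = 0"
proof -
  assume M: "M \<in> pmods r"
  have "h = 0" if "h \<in> Hom r zero_pmod M" for h
    using hcomp_hid_right[OF that] Hom_to_zero[OF hid_Hom[OF zero_pmod]] hcomp_0_right[OF that] by metis
  then have "Hom r zero_pmod M = {0}" using Hom_zero_in[OF M] by blast
  then show ?thesis by (simp add: dim_Hom_def)
qed

lemma dim_Hom_zero_right: "dim_Hom r M zero_pmod = 0"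
proof -
  have "Hom r M zero_pmod = {0}" using Hom_to_zero Hom_zero_in[OF zero_pmod] by blast
  then show ?thesis by (simp add: dim_Hom_def)
qed

lemma dim_Hom_iso_left:
  assumes "finite r" "L \<in> pmods r" "M \<in> pmods r" "A \<in> pmods r" "pmod_iso r L M"
  shows "dim_Hom r L A = dim_Hom r M A"
  using dim_Hom_biproduct_left[OF assms(1-3) zero_pmod assms(4) biproduct_zero[OF assms(5,2,3)]]
    dim_Hom_zero_left[OF assms(4)] by simp

lemma dim_Hom_iso_right:
  assumes "finite r" "L \<in> pmods r" "M \<in> pmods r" "A \<in> pmods r" "pmod_iso r L M"
  shows "dim_Hom r A L = dim_Hom r A M"
  using dim_Hom_biproduct_right[OF assms(1-3) zero_pmod assms(4) biproduct_zero[OF assms(5,2,3)]]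
    dim_Hom_zero_right[of r A] by simp

section \<open>Decomposition and additive functions\<close>

lemma dim_End_pos:
  assumes r: "finite r" and M: "M \<in> pmods r" and "hid r M \<noteq> 0" shows "dim_Hom r M M > 0"
proof -
  obtain B where B: "finite B" "Hom r M M \<subseteq> nat_trans.span B" using Hom_finite_dim[OF r M M] .
  have "card {hid r M} \<le> nat_trans.dim (Hom r M M)"
    by (rule conjunct2[OF nat_trans.card_independent_le_dim[OF B(2,1)]])
      (use assms(3) hid_Hom[OF M] in \<open>simp_all add: nat_trans.dependent_single\<close>)
  then show ?thesis by (simp add: dim_Hom_def)
qed

text \<open>
  Every module is a finite direct sum of indecomposables, in the form of an induction
  principle. Induction is on the dimension of the endomorphism algebra: for a direct sum
  it is at least the sum of those of the two summands, each of which is positive for nonzero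
  summands.
\<close>

lemma pmod_induct [consumes 2, case_names iso zero indecomposable dsum]:
  assumes r: "finite r" and "M \<in> pmods r"
    and iso: "\<And>M N. M \<in> pmods r \<Longrightarrow> N \<in> pmods r \<Longrightarrow> pmod_iso r M N \<Longrightarrow> P N \<Longrightarrow> P M"
    and zero: "P zero_pmod"
    and indec: "\<And>V. V \<in> indecomposables r \<Longrightarrow> P V"
    and dsum: "\<And>M N. M \<in> pmods r \<Longrightarrow> N \<in> pmods r \<Longrightarrow> P M \<Longrightarrow> P N \<Longrightarrow> P (dsum M N)"
  shows "P M"
  using assms(2)
proof (induct "dim_Hom r M M" arbitrary: M rule: less_induct)
  case less
  note M = less.prems
  consider "pmod_iso r M zero_pmod" | "M \<in> indecomposables r"
    | N1 N2 where "N1 \<in> pmods r" "N2 \<in> pmods r" "pmod_iso r M (dsum N1 N2)"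
      "\<not> pmod_iso r N1 zero_pmod" "\<not> pmod_iso r N2 zero_pmod"
    using M unfolding indecomposables_def by blast
  then show ?case
  proof cases
    case 1
    then show ?thesis using iso[OF M zero_pmod] zero by blast
  next
    case 2
    then show ?thesis by (rule indec)
  next
    case 3
    note N = 3(1,2) and D = dsum_pmods[OF 3(1,2)]
    note bi = biproduct_dsum[OF N]
    have "dim_Hom r M M = dim_Hom r (dsum N1 N2) (dsum N1 N2)"
      using dim_Hom_iso_left[OF r M D M 3(3)] dim_Hom_iso_right[OF r M D D 3(3)] by simp
    also have "\<dots> = dim_Hom r N1 N1 + dim_Hom r N1 N2 + (dim_Hom r N2 N1 + dim_Hom r N2 N2)"
      using dim_Hom_biproduct_left[OF r D N D bi] dim_Hom_biproduct_right[OF r D N N(1) bi]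
        dim_Hom_biproduct_right[OF r D N N(2) bi] by simp
    finally have "dim_Hom r N1 N1 < dim_Hom r M M" "dim_Hom r N2 N2 < dim_Hom r M M"
      using dim_End_pos[OF r N(1)] dim_End_pos[OF r N(2)] 3(4,5)
        pmod_iso_zero_iff[OF N(1)] pmod_iso_zero_iff[OF N(2)] by simp_all
    then have "P (dsum N1 N2)" using less.hyps N dsum[OF N] by blast
    then show ?thesis using iso[OF M D 3(3)] by blast
  qed
qed

text \<open>
  These are the integer-valued functions of modules that come from homomorphisms on the split
  Grothendieck group.
\<close>

definition additive_on_pmods :: "'p rel \<Rightarrow> (('p, 'k::field) pmod \<Rightarrow> int) \<Rightarrow> bool" where
  "additive_on_pmods r \<phi> \<longleftrightarrow>
     (\<forall>M\<in>pmods r. \<forall>N\<in>pmods r. pmod_iso r M N \<longrightarrow> \<phi> M = \<phi> N) \<and>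
     (\<forall>M\<in>pmods r. \<forall>N\<in>pmods r. \<phi> (dsum M N) = \<phi> M + \<phi> N)"

lemma additive_iso: "additive_on_pmods r \<phi> \<Longrightarrow> M \<in> pmods r \<Longrightarrow> N \<in> pmods r \<Longrightarrow> pmod_iso r M N \<Longrightarrow> \<phi> M = \<phi> N"
  and additive_dsum: "additive_on_pmods r \<phi> \<Longrightarrow> M \<in> pmods r \<Longrightarrow> N \<in> pmods r \<Longrightarrow> \<phi> (dsum M N) = \<phi> M + \<phi> N"
  by (simp_all add: additive_on_pmods_def)

lemma additive_zero:
  assumes "additive_on_pmods r \<phi>" shows "\<phi> zero_pmod = 0"
  using additive_iso[OF assms zero_pmod dsum_pmods[OF zero_pmod zero_pmod] dsum_zero_right[OF zero_pmod]]
    additive_dsum[OF assms zero_pmod zero_pmod] by simp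

lemma additive_lincomb:
  fixes \<phi> :: "'i \<Rightarrow> ('p, 'k::field) pmod \<Rightarrow> int"
  assumes "\<And>V. V \<in> I \<Longrightarrow> additive_on_pmods r (\<phi> V)"
  shows "additive_on_pmods r (\<lambda>M. \<Sum>V\<in>I. c V * \<phi> V M)"
  unfolding additive_on_pmods_def
proof (intro conjI ballI impI)
  fix M N :: "('p, 'k) pmod" assume MN: "M \<in> pmods r" "N \<in> pmods r"
  show "(\<Sum>V\<in>I. c V * \<phi> V (dsum M N)) = (\<Sum>V\<in>I. c V * \<phi> V M) + (\<Sum>V\<in>I. c V * \<phi> V N)"
    using additive_dsum[OF assms MN] by (simp add: sum.distrib distrib_left)
  assume "pmod_iso r M N"
  then show "(\<Sum>V\<in>I. c V * \<phi> V M) = (\<Sum>V\<in>I. c V * \<phi> V N)"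
    using additive_iso[OF assms MN] by simp
qed

lemma additive_dim_Hom:
  fixes U :: "('p, 'k::field) pmod"
  assumes "finite r" "U \<in> pmods r" shows "additive_on_pmods r (\<lambda>M. int (dim_Hom r U M))"
  unfolding additive_on_pmods_def
proof (intro conjI ballI impI)
  fix M N :: "('p, 'k) pmod" assume MN: "M \<in> pmods r" "N \<in> pmods r"
  show "int (dim_Hom r U (dsum M N)) = int (dim_Hom r U M) + int (dim_Hom r U N)"
    using dim_Hom_biproduct_right[OF assms(1) dsum_pmods[OF MN] MN assms(2) biproduct_dsum[OF MN]] by simp
  assume "pmod_iso r M N"
  then show "int (dim_Hom r U M) = int (dim_Hom r U N)"
    using dim_Hom_iso_right[OF assms(1) MN assms(2)] by simp
qed

lemma is_Ind_indecomposable: "is_Ind r I \<Longrightarrow> V \<in> I \<Longrightarrow> V \<in> indecomposables r"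
  unfolding is_Ind_def representatives_def by blast

lemma is_Ind_pmods: "is_Ind r I \<Longrightarrow> V \<in> I \<Longrightarrow> V \<in> pmods r"
  using is_Ind_indecomposable unfolding indecomposables_def by blast

lemma is_Ind_obtain:
  assumes "is_Ind r I" "V \<in> indecomposables r" obtains W where "W \<in> I" "pmod_iso r V W"
  using assms unfolding is_Ind_def representatives_def by blast

lemma is_Ind_unique:
  assumes I: "is_Ind r I" and "V \<in> I" "W \<in> I" "pmod_iso r V W" shows "V = W"
  using assms is_Ind_indecomposable[OF I] pmod_iso_refl[OF is_Ind_pmods[OF I]]
  unfolding is_Ind_def representatives_def by metis

lemma additive_eqI:
  assumes r: "finite r" and I: "is_Ind r I" and \<phi>: "additive_on_pmods r \<phi>" and \<psi>: "additive_on_pmods r \<psi>"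
    and eq: "\<And>V. V \<in> I \<Longrightarrow> \<phi> V = \<psi> V" and M: "M \<in> pmods r"
  shows "\<phi> M = \<psi> M"
  using r M
proof (induct rule: pmod_induct)
  case (iso M N)
  then show ?case using additive_iso[OF \<phi>] additive_iso[OF \<psi>] by metis
next
  case zero
  then show ?case using additive_zero[OF \<phi>] additive_zero[OF \<psi>] by simp
next
  case (indecomposable V)
  then obtain W where W: "W \<in> I" "pmod_iso r V W" using is_Ind_obtain[OF I] by blast
  have V: "V \<in> pmods r" using indecomposable by (simp add: indecomposables_def)
  show ?case
    using additive_iso[OF \<phi> V is_Ind_pmods[OF I W(1)] W(2)]
      additive_iso[OF \<psi> V is_Ind_pmods[OF I W(1)] W(2)] eq[OF W(1)] by simp
next
  case (dsum M N)
  then show ?case using additive_dsum[OF \<phi>] additive_dsum[OF \<psi>] by simp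
qed

lemma additive_nonneg:
  assumes r: "finite r" and I: "is_Ind r I" and \<phi>: "additive_on_pmods r \<phi>"
    and nn: "\<And>V. V \<in> I \<Longrightarrow> \<phi> V \<ge> 0" and M: "M \<in> pmods r"
  shows "\<phi> M \<ge> 0"
  using r M
proof (induct rule: pmod_induct)
  case (iso M N)
  then show ?case using additive_iso[OF \<phi>] by metis
next
  case zero
  then show ?case using additive_zero[OF \<phi>] by simp
next
  case (indecomposable V)
  then obtain W where W: "W \<in> I" "pmod_iso r V W" using is_Ind_obtain[OF I] by blast
  have V: "V \<in> pmods r" using indecomposable by (simp add: indecomposables_def)
  show ?case using additive_iso[OF \<phi> V is_Ind_pmods[OF I W(1)] W(2)] nn[OF W(1)] by simp
next
  case (dsum M N)
  then show ?case using additive_dsum[OF \<phi>] by simp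
qed

text \<open>
  The coefficients are the multiplicities in some decomposition of \<^term>\<open>E\<close>.
\<close>

lemma dim_Hom_decompose:
  assumes r: "finite r" and I: "is_Ind r I" "finite I" and E: "E \<in> pmods r"
  shows "\<exists>n. \<forall>M\<in>pmods r. int (dim_Hom r E M) = (\<Sum>V\<in>I. n V * int (dim_Hom r V M))"
  using r E
proof (induct rule: pmod_induct)
  case (iso M N)
  then show ?case using dim_Hom_iso_left[OF r iso(1,2) _ iso(3)] by metis
next
  case zero
  then show ?case by (intro exI[of _ "\<lambda>_. 0"]) (simp add: dim_Hom_zero_left)
next
  case (indecomposable V)
  then obtain W where W: "W \<in> I" "pmod_iso r V W" using is_Ind_obtain[OF I(1)] by blast
  have V: "V \<in> pmods r" using indecomposable by (simp add: indecomposables_def)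
  have "int (dim_Hom r V M) = (\<Sum>W'\<in>I. (if W' = W then 1 else 0) * int (dim_Hom r W' M))"
    if "M \<in> pmods r" for M
    using dim_Hom_iso_left[OF r V is_Ind_pmods[OF I(1) W(1)] that W(2)] W(1) I(2)
    by (simp add: if_distrib[of "\<lambda>x. x * _"] cong: if_cong)
  then show ?case by (intro exI[of _ "\<lambda>W'. if W' = W then 1 else 0"] ballI)
next
  case (dsum M N)
  then obtain m n where mn: "\<And>A. A \<in> pmods r \<Longrightarrow> int (dim_Hom r M A) = (\<Sum>V\<in>I. m V * int (dim_Hom r V A))"
    "\<And>A. A \<in> pmods r \<Longrightarrow> int (dim_Hom r N A) = (\<Sum>V\<in>I. n V * int (dim_Hom r V A))" by blast
  have "int (dim_Hom r (dsum M N) A) = (\<Sum>V\<in>I. (m V + n V) * int (dim_Hom r V A))" if A: "A \<in> pmods r" for A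
    using dim_Hom_biproduct_left[OF r dsum_pmods[OF dsum(1,2)] dsum(1,2) A biproduct_dsum[OF dsum(1,2)]]
      mn[OF A] by (simp add: sum.distrib distrib_right)
  then show ?case by (intro exI[of _ "\<lambda>V. m V + n V"] ballI)
qed

section \<open>Endomorphisms of indecomposables\<close>

definition End_monoid :: "'p rel \<Rightarrow> ('p, 'k::field) pmod \<Rightarrow> ('p \<Rightarrow> 'k vec \<Rightarrow> 'k vec) monoid" where
  "End_monoid r M = \<lparr>carrier = Hom r M M, mult = hcomp, one = hid r M\<rparr>"

lemma End_monoid_simps [simp]:
  "carrier (End_monoid r M) = Hom r M M" "x \<otimes>\<^bsub>End_monoid r M\<^esub> y = x \<bullet> y" "\<one>\<^bsub>End_monoid r M\<^esub> = hid r M"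
  by (simp_all add: End_monoid_def)

lemma monoid_End: "M \<in> pmods r \<Longrightarrow> monoid (End_monoid r M)"
  by unfold_locales (simp_all add: hcomp_Hom hcomp_assoc hid_Hom hcomp_hid_left hcomp_hid_right)

text \<open>
  The spaces \<^term>\<open>W n\<close> of the multiples \<open>a\<^sup>n b\<close>, where \<open>b\<close> commutes with \<open>a\<close>, form a decreasing
  chain of subspaces of a finite-dimensional space.
\<close>

lemma End_power_stabilizes:
  assumes r: "finite r" and U: "U \<in> pmods r" and a: "a \<in> Hom r U U"
  obtains n b where "b \<in> Hom r U U" "a \<bullet> b = b \<bullet> a"
    "a [^]\<^bsub>End_monoid r U\<^esub> (n::nat) = a [^]\<^bsub>End_monoid r U\<^esub> n \<bullet> (a \<bullet> b)"
proof -
  interpret monoid "End_monoid r U" using monoid_End[OF U] .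
  let ?pw = "\<lambda>n::nat. a [^]\<^bsub>End_monoid r U\<^esub> n"
  have pw: "?pw n \<in> Hom r U U" for n using nat_pow_closed[of a n] a by simp
  obtain B where B: "finite B" "Hom r U U \<subseteq> nat_trans.span B" using Hom_finite_dim[OF r U U] .
  define Z where "Z = {b \<in> Hom r U U. a \<bullet> b = b \<bullet> a}"
  have Zid: "hid r U \<in> Z" using hid_Hom[OF U] hcomp_hid_left[OF a] hcomp_hid_right[OF a] by (simp add: Z_def)
  have aZ: "a \<bullet> b \<in> Z" if "b \<in> Z" for b
  proof -
    have b: "b \<in> Hom r U U" "a \<bullet> b = b \<bullet> a" using that by (simp_all add: Z_def)
    have "a \<bullet> (a \<bullet> b) = a \<bullet> b \<bullet> a" unfolding hcomp_assoc by (simp only: b(2))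
    then show ?thesis using hcomp_Hom[OF a b(1)] by (simp add: Z_def)
  qed
  have Z_add: "x + y \<in> Z" if "x \<in> Z" "y \<in> Z" for x y
    using that Hom_plus[OF U] hcomp_add_right[OF a, of x U y] by (simp add: Z_def hcomp_add_left)
  have Z_scale: "(\<lambda>p v i. c * x p v i) \<in> Z" if "x \<in> Z" for x c
    using that hcomp_scale_right[OF a, of x U c] nat_trans.subspace_scale[OF subspace_Hom[OF U]]
    by (simp add: Z_def hcomp_scale_left)
  have Z_0: "0 \<in> Z" using Hom_zero_in[OF U] hcomp_0_right[OF a] by (simp add: Z_def)
  have ZH: "Z \<subseteq> Hom r U U" by (auto simp: Z_def)
  define W where "W n = (\<lambda>b. ?pw n \<bullet> b) ` Z" for n
  have WH: "W n \<subseteq> Hom r U U" for n using hcomp_Hom[OF pw] ZH by (auto simp: W_def)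
  have W_sub: "nat_trans.subspace (W n)" for n
    unfolding nat_trans.subspace_def
  proof (intro conjI ballI allI)
    show "0 \<in> W n" using hcomp_0_right[OF pw, of n] Z_0 unfolding W_def by (metis image_eqI)
  next
    fix x y assume "x \<in> W n" "y \<in> W n"
    then obtain b c where bc: "b \<in> Z" "c \<in> Z" "x = ?pw n \<bullet> b" "y = ?pw n \<bullet> c" by (auto simp: W_def)
    have "b \<in> Hom r U U" "c \<in> Hom r U U" using bc ZH by blast+
    then have "x + y = ?pw n \<bullet> (b + c)" using hcomp_add_right[OF pw, of b U c n] bc by simp
    then show "x + y \<in> W n" using Z_add[OF bc(1,2)] by (auto simp: W_def)
  next
    fix c x assume "x \<in> W n"
    then obtain b where b: "b \<in> Z" "x = ?pw n \<bullet> b" by (auto simp: W_def)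
    have "b \<in> Hom r U U" using b ZH by blast
    then have "(\<lambda>p v i. c * x p v i) = ?pw n \<bullet> (\<lambda>p v i. c * b p v i)"
      using hcomp_scale_right[OF pw, of b U n c] b by simp
    then show "(\<lambda>p v i. c * x p v i) \<in> W n" using Z_scale[OF b(1)] by (auto simp: W_def)
  qed
  have dec: "W (Suc n) \<subseteq> W n" for n
  proof
    fix x assume "x \<in> W (Suc n)"
    then obtain b where b: "b \<in> Z" "x = ?pw (Suc n) \<bullet> b" by (auto simp: W_def)
    then have "x = ?pw n \<bullet> (a \<bullet> b)" by (simp add: hcomp_assoc)
    then show "x \<in> W n" using aZ[OF b(1)] by (auto simp: W_def)
  qed
  \<comment> \<open>A sequence of natural numbers cannot decrease strictly for ever, so the chain stops.\<close>
  obtain n where "\<forall>m. nat_trans.dim (W n) \<le> nat_trans.dim (W m)"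
    using ex_has_least_nat[of "\<lambda>_. True" 0 "\<lambda>n. nat_trans.dim (W n)"] by auto
  then have "nat_trans.dim (W n) \<le> nat_trans.dim (W (Suc n))" by blast
  then have "W (Suc n) = W n"
    using nat_trans.subspace_eq_if_dim_le[OF order_trans[OF WH B(2)] B(1) dec W_sub] by blast
  moreover have "?pw n \<in> W n"
    using hcomp_hid_right[OF pw, of n] Zid unfolding W_def by (metis image_eqI)
  ultimately obtain b where "b \<in> Z" "?pw n = ?pw (Suc n) \<bullet> b" by (auto simp: W_def)
  then show thesis using that[of b n] by (simp add: Z_def hcomp_assoc)
qed

text \<open>
  Fitting's lemma. If \<open>a\<^sup>n = a\<^sup>n (a b)\<close> with commuting \<open>a\<close> and \<open>b\<close>, then \<open>(a b)\<^sup>n\<close> is idempotent, hence zero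
  or the identity. In the first case \<open>a\<^sup>n\<close> is zero, in the second case \<open>a\<close> is invertible.
\<close>

lemma End_unit_or_nilpotent:
  assumes r: "finite r" and U: "U \<in> indecomposables r" and a: "a \<in> Hom r U U"
    and nonunit: "a \<notin> Units (End_monoid r U)"
  obtains n :: nat where "a [^]\<^bsub>End_monoid r U\<^esub> n = 0"
proof -
  have Up: "U \<in> pmods r" using U by (simp add: indecomposables_def)
  interpret monoid "End_monoid r U" using monoid_End[OF Up] .
  obtain n b where b: "b \<in> Hom r U U" "a \<bullet> b = b \<bullet> a"
    "a [^]\<^bsub>End_monoid r U\<^esub> (n::nat) = a [^]\<^bsub>End_monoid r U\<^esub> n \<bullet> (a \<bullet> b)"
    using End_power_stabilizes[OF r Up a] .
  let ?pw = "\<lambda>x n::nat. x [^]\<^bsub>End_monoid r U\<^esub> n"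
  have pw: "?pw x n \<in> Hom r U U" if "x \<in> Hom r U U" for x n using nat_pow_closed[of x n] that by simp
  define c where "c = a \<bullet> b"
  have c: "c \<in> Hom r U U" using hcomp_Hom[OF a b(1)] by (simp add: c_def)
  \<comment> \<open>The equation for \<open>c = a b\<close> iterates to \<open>a\<^sup>n = a\<^sup>n c\<^sup>m\<close>; the case \<open>m = n\<close> makes \<open>c\<^sup>n\<close> idempotent.\<close>
  have anc: "?pw a n = ?pw a n \<bullet> ?pw c m" for m
  proof (induct m)
    case 0
    then show ?case using hcomp_hid_right[OF pw[OF a]] by simp
  next
    case (Suc m)
    have "?pw a n \<bullet> ?pw c (Suc m) = (?pw a n \<bullet> ?pw c m) \<bullet> c" by (simp add: hcomp_assoc)
    also have "\<dots> = ?pw a n" using Suc b(3) by (simp add: c_def)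
    finally show ?case by simp
  qed
  have cn: "?pw c n = ?pw a n \<bullet> ?pw b n"
    using pow_mult_distrib[of a b n] a b by (simp add: c_def)
  have cc: "?pw c n \<bullet> ?pw c m = ?pw c m \<bullet> ?pw c n" for m
    using nat_pow_comm[of c n m] c by simp
  have comm: "b \<bullet> c = c \<bullet> b" unfolding c_def hcomp_assoc[symmetric] by (simp only: b(2))
  have bc: "?pw b n \<bullet> ?pw c n = ?pw c n \<bullet> ?pw b n"
  proof -
    have "?pw b n \<bullet> c = c \<bullet> ?pw b n" using group_commutes_pow[of b c n] b(1) c comm by simp
    then have "?pw c n \<bullet> ?pw b n = ?pw b n \<bullet> ?pw c n"
      using group_commutes_pow[of c "?pw b n" n] pw[OF b(1)] c by simp
    then show ?thesis by simp
  qed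
  have "?pw c n \<bullet> ?pw c n = ?pw a n \<bullet> (?pw b n \<bullet> ?pw c n)" by (simp add: cn hcomp_assoc)
  also have "\<dots> = ?pw a n \<bullet> ?pw c n \<bullet> ?pw b n" by (simp add: bc hcomp_assoc)
  also have "\<dots> = ?pw c n" using anc[of n] cn by simp
  finally have "?pw c n = 0 \<or> ?pw c n = hid r U"
    using indecomposable_idempotent[OF U pw[OF c]] by blast
  then show thesis
  proof
    assume "?pw c n = 0"
    then have "?pw a n = 0" using anc[of n] hcomp_0_right[OF pw[OF a]] by simp
    then show thesis by (rule that)
  next
    assume id: "?pw c n = hid r U"
    \<comment> \<open>A positive exponent is needed to split off a factor \<open>a\<close>.\<close>
    have "\<exists>m. ?pw c (Suc m) = hid r U"
    proof (cases n)
      case 0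
      then have "c = hid r U" using b(3) hcomp_hid_left[OF c] by (simp add: c_def)
      then show ?thesis using hcomp_hid_left[OF c] by (intro exI[of _ 0]) simp
    qed (use id in blast)
    then obtain m where m: "?pw c (Suc m) = hid r U" ..
    have "?pw c m \<bullet> b \<bullet> a = hid r U" using m b(2) by (simp add: c_def hcomp_assoc)
    moreover have "a \<bullet> (b \<bullet> ?pw c m) = hid r U"
      using m nat_pow_Suc2[of c m] c by (simp add: c_def hcomp_assoc)
    moreover have "?pw c m \<bullet> b = b \<bullet> ?pw c m"
      using group_commutes_pow[of c b m] b(1) c comm by simp
    ultimately have "a \<in> Units (End_monoid r U)"
      using a hcomp_Hom[OF b(1) pw[OF c]] by (auto simp: Units_def)
    then show thesis using nonunit by simp
  qed
qed

lemma indecomposable_hid: "U \<in> indecomposables r \<Longrightarrow> hid r U \<noteq> 0"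
  using pmod_iso_zero_iff[of U r] unfolding indecomposables_def by blast

text \<open>
  The endomorphism ring is local. If the sum of two non-units were a unit, then after
  multiplication with its inverse the two summands would be non-units, hence nilpotent, and add up
  to the identity.
\<close>

lemma End_local:
  assumes r: "finite r" and U: "U \<in> indecomposables r"
    and a: "a \<in> Hom r U U" "a \<notin> Units (End_monoid r U)"
    and b: "b \<in> Hom r U U" "b \<notin> Units (End_monoid r U)"
  shows "a + b \<notin> Units (End_monoid r U)"
proof
  have Up: "U \<in> pmods r" using U by (simp add: indecomposables_def)
  interpret monoid "End_monoid r U" using monoid_End[OF Up] .
  let ?pw = "\<lambda>x n::nat. x [^]\<^bsub>End_monoid r U\<^esub> n"
  have pw: "?pw x n \<in> Hom r U U" if "x \<in> Hom r U U" for x n using nat_pow_closed[of x n] that by simp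
  assume w: "a + b \<in> Units (End_monoid r U)"
  then obtain w where w': "w \<in> Hom r U U" "w \<bullet> (a + b) = hid r U" "(a + b) \<bullet> w = hid r U"
    by (auto simp: Units_def)
  have nonunit: "w \<bullet> x \<notin> Units (End_monoid r U)" if "x \<in> Hom r U U" "x \<notin> Units (End_monoid r U)" for x
  proof
    assume "w \<bullet> x \<in> Units (End_monoid r U)"
    then have "(a + b) \<bullet> (w \<bullet> x) \<in> Units (End_monoid r U)" using Units_m_closed[OF w] by simp
    moreover have "(a + b) \<bullet> (w \<bullet> x) = x"
      using w'(3) hcomp_hid_left[OF that(1)] by (simp add: hcomp_assoc[symmetric])
    ultimately show False using that by simp
  qed
  have wa: "w \<bullet> a \<in> Hom r U U" and wb: "w \<bullet> b \<in> Hom r U U" using hcomp_Hom w'(1) a(1) b(1) by blast+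
  have sum: "w \<bullet> a + w \<bullet> b = hid r U" using w'(2) hcomp_add_right[OF w'(1) a(1) b(1)] by simp
  obtain n where n: "?pw (w \<bullet> a) n = 0" using End_unit_or_nilpotent[OF r U wa nonunit[OF a]] .
  obtain m where m: "?pw (w \<bullet> b) m = 0" using End_unit_or_nilpotent[OF r U wb nonunit[OF b]] .
  define k where "k = (LEAST n. ?pw (w \<bullet> a) n = 0)"
  have k: "?pw (w \<bullet> a) k = 0" and min: "\<And>l. ?pw (w \<bullet> a) l = 0 \<Longrightarrow> k \<le> l"
    unfolding k_def using n by (auto intro: LeastI Least_le)
  have "k \<noteq> 0" using k indecomposable_hid[OF U] by (cases k) auto
  then obtain l where l: "k = Suc l" by (cases k) auto
  let ?z = "?pw (w \<bullet> a) l"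
  have z: "?z \<in> Hom r U U" using pw[OF wa] .
  have za: "?z \<bullet> (w \<bullet> a) = 0" using k l by simp
  \<comment> \<open>As the two elements add up to the identity, the second one fixes \<open>?z\<close>, but it is nilpotent.\<close>
  have "?z = ?z \<bullet> (w \<bullet> a + w \<bullet> b)" using sum hcomp_hid_right[OF z] by simp
  then have zb: "?z = ?z \<bullet> (w \<bullet> b)" using hcomp_add_right[OF z wa wb] za by simp
  have "?z = ?z \<bullet> ?pw (w \<bullet> b) m"
  proof (induct m)
    case 0
    then show ?case using hcomp_hid_right[OF z] by simp
  next
    case (Suc m)
    then show ?case using zb by (simp add: hcomp_assoc[symmetric])
  qed
  then have "?z = 0" using m hcomp_0_right[OF z] by simp
  then show False using min[of l] l by simp
qed

section \<open>Left almost split maps\<close>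

lemma retract_of_indecomposable:
  assumes U: "U \<in> indecomposables r" and V: "V \<in> indecomposables r"
    and h: "h \<in> Hom r U V" and k: "k \<in> Hom r V U" and unit: "k \<bullet> h \<in> Units (End_monoid r U)"
  shows "pmod_iso r U V"
proof -
  have Up: "U \<in> pmods r" using U by (simp add: indecomposables_def)
  obtain w where w: "w \<in> Hom r U U" "w \<bullet> (k \<bullet> h) = hid r U" using unit by (auto simp: Units_def)
  define t where "t = w \<bullet> k"
  have t: "t \<in> Hom r V U" "t \<bullet> h = hid r U" using hcomp_Hom[OF w(1) k] w(2) by (simp_all add: t_def hcomp_assoc)
  have "h \<bullet> t \<bullet> (h \<bullet> t) = h \<bullet> (t \<bullet> h \<bullet> t)" by (simp add: hcomp_assoc)
  then have "h \<bullet> t \<bullet> (h \<bullet> t) = h \<bullet> t" using t hcomp_hid_left[OF t(1)] by simp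
  then have "h \<bullet> t = 0 \<or> h \<bullet> t = hid r V"
    using indecomposable_idempotent[OF V hcomp_Hom[OF h t(1)]] by blast
  moreover have "h \<bullet> t \<noteq> 0"
  proof
    assume "h \<bullet> t = 0"
    then have "t \<bullet> (h \<bullet> t) \<bullet> h = 0" using hcomp_0_right[OF t(1)] by simp
    moreover have "t \<bullet> (h \<bullet> t) \<bullet> h = hid r U"
      using t(2) hcomp_hid_left[OF hid_Hom[OF Up]] by (simp add: hcomp_assoc[symmetric]) (simp add: hcomp_assoc)
    ultimately show False using indecomposable_hid[OF U] by simp
  qed
  ultimately show ?thesis unfolding pmod_iso_iff using h t by blast
qed

text \<open>
  A finite family of homomorphisms from \<^term>\<open>U\<close> to indecomposables other than \<^term>\<open>U\<close> is
  collected into one homomorphism to the direct sum \<^term>\<open>E\<close> of the targets. An endomorphism of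
  \<^term>\<open>U\<close> that factors through it is a sum of endomorphisms that factor through one of the targets.
  Those are no units because \<^term>\<open>U\<close> is not a retract of another indecomposable, and
  by locality their sum is no unit either.
\<close>

lemma joint_factorization_without_retraction:
  fixes r :: "'p rel" and U :: "('p, 'k::field) pmod"
  assumes r: "finite r" and I: "is_Ind r I" and U: "U \<in> I"
    and R: "finite R" "\<And>V h. (V, h) \<in> R \<Longrightarrow> V \<in> I - {U} \<and> h \<in> Hom r U V"
  shows "\<exists>E\<in>pmods r. \<exists>u\<in>Hom r U E. (\<forall>V h. (V, h) \<in> R \<longrightarrow> (\<exists>k\<in>Hom r E V. k \<bullet> u = h)) \<and>
    (\<forall>k\<in>Hom r E U. k \<bullet> u \<notin> Units (End_monoid r U))"
  using R
proof (induct R)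
  case empty
  have Ui: "U \<in> indecomposables r" using is_Ind_indecomposable[OF I U] .
  have "0 \<notin> Units (End_monoid r U)"
    using indecomposable_hid[OF Ui] by (auto simp: Units_def)
  moreover have "k \<bullet> 0 = 0" if "k \<in> Hom r zero_pmod U" for k using hcomp_0_right[OF that] .
  ultimately have "k \<bullet> 0 \<notin> Units (End_monoid r U)" if "k \<in> Hom r zero_pmod U" for k
    using that by simp
  then show ?case
    using zero_pmod Hom_zero_in[OF zero_pmod]
    by (intro bexI[of _ zero_pmod] bexI[of _ "0 :: 'p \<Rightarrow> 'k vec \<Rightarrow> 'k vec"] conjI ballI) blast+
next
  case (insert x R)
  obtain V h where x: "x = (V, h)" by (cases x)
  have V: "V \<in> I" "V \<noteq> U" and h: "h \<in> Hom r U V" using insert.prems[of V h] x by auto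
  obtain E u where E: "E \<in> pmods r" "u \<in> Hom r U E" "\<And>V h. (V, h) \<in> R \<Longrightarrow> \<exists>k\<in>Hom r E V. k \<bullet> u = h"
    "\<And>k. k \<in> Hom r E U \<Longrightarrow> k \<bullet> u \<notin> Units (End_monoid r U)"
    using insert.hyps(3)[OF insert.prems[OF insertI2]] by blast
  have Ui: "U \<in> indecomposables r" and Vi: "V \<in> indecomposables r"
    using is_Ind_indecomposable[OF I] U V(1) by blast+
  have Vp: "V \<in> pmods r" using is_Ind_pmods[OF I V(1)] .
  let ?L = "dsum V E"
  have L: "?L \<in> pmods r" using dsum_pmods[OF Vp E(1)] .
  obtain i1 i2 p1 p2 where b: "i1 \<in> Hom r V ?L" "i2 \<in> Hom r E ?L" "p1 \<in> Hom r ?L V" "p2 \<in> Hom r ?L E"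
    "p1 \<bullet> i1 = hid r V" "p2 \<bullet> i2 = hid r E" "p1 \<bullet> i2 = 0" "p2 \<bullet> i1 = 0" "i1 \<bullet> p1 + i2 \<bullet> p2 = hid r ?L"
    using biproduct_dsum[OF Vp E(1)] unfolding biproduct_def by blast
  define u' where "u' = i1 \<bullet> h + i2 \<bullet> u"
  note ih = hcomp_Hom[OF b(1) h] and iu = hcomp_Hom[OF b(2) E(2)]
  have u': "u' \<in> Hom r U ?L" unfolding u'_def using Hom_plus[OF L ih iu] .
  have p1u': "p1 \<bullet> u' = h"
    unfolding u'_def hcomp_add_right[OF b(3) ih iu] hcomp_assoc[symmetric] b(5,7)
    using hcomp_hid_left[OF h] by simp
  have p2u': "p2 \<bullet> u' = u"
    unfolding u'_def hcomp_add_right[OF b(4) ih iu] hcomp_assoc[symmetric] b(6,8)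
    using hcomp_hid_left[OF E(2)] by simp
  have "\<exists>k\<in>Hom r ?L V'. k \<bullet> u' = h'" if "(V', h') \<in> insert x R" for V' h'
  proof (cases "(V', h') = x")
    case True
    then show ?thesis using p1u' b(3) x by auto
  next
    case False
    then have "(V', h') \<in> R" using that by simp
    then obtain k where k: "k \<in> Hom r E V'" "k \<bullet> u = h'" using E(3) by blast
    have "k \<bullet> p2 \<bullet> u' = h'" using p2u' k(2) by (simp add: hcomp_assoc)
    then show ?thesis using hcomp_Hom[OF k(1) b(4)] by blast
  qed
  moreover have "k \<bullet> u' \<notin> Units (End_monoid r U)" if k: "k \<in> Hom r ?L U" for k
  proof -
    have ki: "k \<bullet> i1 \<in> Hom r V U" "k \<bullet> i2 \<in> Hom r E U" using hcomp_Hom[OF k] b(1,2) by blast+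
    have "k \<bullet> u' = (k \<bullet> i1) \<bullet> h + (k \<bullet> i2) \<bullet> u"
      unfolding u'_def hcomp_add_right[OF k ih iu] by (simp add: hcomp_assoc)
    moreover have "(k \<bullet> i1) \<bullet> h \<notin> Units (End_monoid r U)"
      using retract_of_indecomposable[OF Ui Vi h ki(1)] is_Ind_unique[OF I U V(1)] V(2) by blast
    ultimately show ?thesis
      using End_local[OF r Ui hcomp_Hom[OF ki(1) h] _ hcomp_Hom[OF ki(2) E(2)] E(4)[OF ki(2)]] by simp
  qed
  ultimately show ?case using L u' by (intro bexI[of _ ?L] bexI[of _ u'] conjI) blast+
qed

text \<open>
  Apply the previous lemma to bases of the spaces \<^term>\<open>Hom r U V\<close>. This is where representation
  finiteness enters: only finitely many targets \<^term>\<open>V\<close> can be put into one finite direct sum.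
  In contrast to the classical notion, radical endomorphisms of \<^term>\<open>U\<close> are not asked to factor
  through \<open>u\<close>; accordingly, the codimension counted below may exceed that of the radical.
\<close>

lemma left_almost_split:
  assumes r: "finite r" and I: "is_Ind r I" "finite I" and U: "U \<in> I"
  obtains E u where "E \<in> pmods r" "u \<in> Hom r U E"
    "\<And>V h. V \<in> I \<Longrightarrow> V \<noteq> U \<Longrightarrow> h \<in> Hom r U V \<Longrightarrow> \<exists>k\<in>Hom r E V. k \<bullet> u = h"
    "\<And>k. k \<in> Hom r E U \<Longrightarrow> k \<bullet> u \<noteq> hid r U"
proof -
  have Up: "U \<in> pmods r" using is_Ind_pmods[OF I(1) U] .
  have "\<exists>K. finite K \<and> K \<subseteq> Hom r U V \<and> Hom r U V \<subseteq> nat_trans.span K" if V: "V \<in> I" for V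
  proof -
    obtain B where B: "finite B" "Hom r U V \<subseteq> nat_trans.span B"
      using Hom_finite_dim[OF r Up is_Ind_pmods[OF I(1) V]] .
    obtain K where "K \<subseteq> Hom r U V" "nat_trans.independent K" "finite K" "Hom r U V \<subseteq> nat_trans.span K"
      "card K = nat_trans.dim (Hom r U V)"
      using nat_trans.finite_basis_exists[OF B(2,1)] .
    then show ?thesis by auto
  qed
  then obtain K where K: "\<And>V. V \<in> I \<Longrightarrow> finite (K V) \<and> K V \<subseteq> Hom r U V \<and> Hom r U V \<subseteq> nat_trans.span (K V)"
    by metis
  define R where "R = (SIGMA V : I - {U}. K V)"
  have finR: "finite R" using K I(2) by (auto simp: R_def)
  have R: "V \<in> I - {U} \<and> h \<in> Hom r U V" if "(V, h) \<in> R" for V h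
    using that K by (auto simp: R_def)
  obtain E u where E: "E \<in> pmods r" "u \<in> Hom r U E" "\<And>V h. (V, h) \<in> R \<Longrightarrow> \<exists>k\<in>Hom r E V. k \<bullet> u = h"
    "\<forall>k\<in>Hom r E U. k \<bullet> u \<notin> Units (End_monoid r U)"
    using joint_factorization_without_retraction[OF r I(1) U finR R] by auto
  have "\<exists>k\<in>Hom r E V. k \<bullet> u = h" if V: "V \<in> I" "V \<noteq> U" and h: "h \<in> Hom r U V" for V h
  proof -
    have Vp: "V \<in> pmods r" using is_Ind_pmods[OF I(1) V(1)] .
    have "nat_trans.subspace {h. \<exists>k\<in>Hom r E V. k \<bullet> u = h}"
      unfolding nat_trans.subspace_def
    proof (intro conjI ballI allI)
      show "0 \<in> {h. \<exists>k\<in>Hom r E V. k \<bullet> u = h}" 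
        using Hom_zero_in[OF Vp, of E] hcomp_0_left[of u] by blast
      show "x + y \<in> {h. \<exists>k\<in>Hom r E V. k \<bullet> u = h}"
        if "x \<in> {h. \<exists>k\<in>Hom r E V. k \<bullet> u = h}" "y \<in> {h. \<exists>k\<in>Hom r E V. k \<bullet> u = h}" for x y
        using that Hom_plus[OF Vp] hcomp_add_left by blast
      show "(\<lambda>p v i. c * x p v i) \<in> {h. \<exists>k\<in>Hom r E V. k \<bullet> u = h}"
        if "x \<in> {h. \<exists>k\<in>Hom r E V. k \<bullet> u = h}" for c x
        using that nat_trans.subspace_scale[OF subspace_Hom[OF Vp]] hcomp_scale_left by blast
    qed
    moreover have "K V \<subseteq> {h. \<exists>k\<in>Hom r E V. k \<bullet> u = h}"
      using E(3)[of V] V by (auto simp: R_def)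
    ultimately have "nat_trans.span (K V) \<subseteq> {h. \<exists>k\<in>Hom r E V. k \<bullet> u = h}"
      by (intro nat_trans.span_minimal)
    then show ?thesis using K[OF V(1)] h by blast
  qed
  moreover have "k \<bullet> u \<noteq> hid r U" if "k \<in> Hom r E U" for k
    using E(4) that monoid.Units_one_closed[OF monoid_End[OF Up]] by auto
  ultimately show thesis using that E(1,2) by blast
qed

section \<open>Cokernels\<close>

text \<open>
  At every point \<open>p\<close> of the poset the cokernel is the image of a projection \<open>\<pi> p\<close> with
  kernel \<open>S p\<close>, the image of \<^term>\<open>u\<close>. Structure maps are those of \<^term>\<open>E\<close> followed by
  the projection.
\<close>

lemma cokernel_exists:
  fixes r :: "'p rel" and E :: "('p, 'k::field) pmod"
  assumes E: "E \<in> pmods r" and U: "U \<in> pmods r" and u: "u \<in> Hom r U E"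
  obtains C \<pi> where "C \<in> pmods r" "\<pi> \<in> Hom r E C" "\<pi> \<bullet> u = 0"
    "\<And>M h. h \<in> Hom r E M \<Longrightarrow> h \<bullet> u = 0 \<Longrightarrow> \<exists>k\<in>Hom r C M. h = k \<bullet> \<pi>"
    "\<And>M k. k \<in> Hom r C M \<Longrightarrow> k \<bullet> \<pi> = 0 \<Longrightarrow> k = 0"
proof -
  define S where "S p = u p ` pspace U p" for p
  have S_sub: "vec.subspace (S p)" if p: "p \<in> Field r" for p
    unfolding vec.subspace_def
  proof (intro conjI ballI allI)
    show "0 \<in> S p" unfolding S_def using Hom_0[OF u, of p] pmods_0[OF U p] by (metis image_eqI)
  next
    fix x y assume "x \<in> S p" "y \<in> S p"
    then obtain v w where v: "v \<in> pspace U p" "w \<in> pspace U p" "x = u p v" "y = u p w"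
      by (auto simp: S_def)
    then have "x + y = u p (v + w)" using Hom_add[OF u p] by simp
    then show "x + y \<in> S p" unfolding S_def using pmods_add[OF U p v(1,2)] by (metis image_eqI)
  next
    fix c x assume "x \<in> S p"
    then obtain v where v: "v \<in> pspace U p" "x = u p v" by (auto simp: S_def)
    then have "(\<lambda>i. c * x i) = u p (\<lambda>i. c * v i)" using Hom_scale[OF u p] by simp
    then show "(\<lambda>i. c * x i) \<in> S p" unfolding S_def using pmods_scale[OF U p v(1)] by (metis image_eqI)
  qed
  have S_E: "S p \<subseteq> pspace E p" if "p \<in> Field r" for p
    using Hom_in[OF u that] by (auto simp: S_def)
  have S_trans: "trans_map E p q x \<in> S q" if pq: "(p, q) \<in> r" and x: "x \<in> S p" for p q x
  proof -
    obtain v where v: "v \<in> pspace U p" "x = u p v" using x by (auto simp: S_def)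
    then have "trans_map E p q x = u q (trans_map U p q v)" using Hom_natural[OF u pq] by simp
    then show ?thesis using trans_in[OF U pq v(1)] by (simp add: S_def)
  qed
  define good where "good p \<pi> \<longleftrightarrow> Vector_Spaces.linear (\<lambda>c v i. c * v i) (\<lambda>c v i. c * v i) \<pi> \<and>
    (\<forall>v\<in>S p. \<pi> v = 0) \<and> (\<forall>v. v - \<pi> v \<in> S p)" for p and \<pi> :: "'k vec \<Rightarrow> 'k vec"
  have "\<exists>\<pi>. good p \<pi>" if p: "p \<in> Field r" for p
  proof -
    obtain \<pi> where "Vector_Spaces.linear (\<lambda>c v i. c * v i) (\<lambda>c v i. c * v i) \<pi>"
      "\<And>v. v \<in> S p \<Longrightarrow> \<pi> v = 0" "\<And>v. v - \<pi> v \<in> S p"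
      using vec.projection_with_kernel[OF S_sub[OF p]] by blast
    then show ?thesis unfolding good_def by blast
  qed
  then obtain \<pi> where good: "\<And>p. p \<in> Field r \<Longrightarrow> good p (\<pi> p)" by metis
  have vlin: "Vector_Spaces.linear (\<lambda>c v i. c * v i) (\<lambda>c v i. c * v i) (\<pi> p)" if "p \<in> Field r" for p
    using good[OF that] by (simp add: good_def)
  have \<pi>S: "\<pi> p v = 0" if "p \<in> Field r" "v \<in> S p" for p v using good[OF that(1)] that by (simp add: good_def)
  have S\<pi>: "v - \<pi> p v \<in> S p" if "p \<in> Field r" for p v using good[OF that(1)] by (simp add: good_def)
  have \<pi>add: "\<pi> p (v + w) = \<pi> p v + \<pi> p w" if "p \<in> Field r" for p v w
    using vlin[OF that] by (simp add: Vector_Spaces.linear_iff)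
  have \<pi>scale: "\<pi> p (\<lambda>i. c * v i) = (\<lambda>i. c * \<pi> p v i)" if "p \<in> Field r" for p c v
    using vlin[OF that] by (simp add: Vector_Spaces.linear_iff)
  have \<pi>E: "\<pi> p v \<in> pspace E p" if p: "p \<in> Field r" and v: "v \<in> pspace E p" for p v
  proof -
    have "v - \<pi> p v \<in> pspace E p" using S\<pi>[OF p] S_E[OF p] by blast
    then have "v - (v - \<pi> p v) \<in> pspace E p"
      using vec.subspace_diff[OF subspace_pspace[OF E p] v] by blast
    then show ?thesis by simp
  qed
  have split: "\<exists>s\<in>S p. v = s + \<pi> p v" if "p \<in> Field r" for p v
    using S\<pi>[OF that, of v] by (intro bexI[of _ "v - \<pi> p v"]) simp_all
  have \<pi>\<pi>: "\<pi> p (\<pi> p v) = \<pi> p v" if p: "p \<in> Field r" for p v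
    using split[OF p, of v] \<pi>S[OF p] \<pi>add[OF p] by (metis add_0)
  \<comment> \<open>The structure maps of \<open>E\<close> respect the images of \<open>u\<close>, so projecting first makes no difference.\<close>
  have \<pi>trans: "\<pi> q (trans_map E p q (\<pi> p v)) = \<pi> q (trans_map E p q v)"
    if pq: "(p, q) \<in> r" and v: "v \<in> pspace E p" for p q v
  proof -
    have p: "p \<in> Field r" and q: "q \<in> Field r" using pq by (auto intro: FieldI1 FieldI2)
    obtain s where s: "s \<in> S p" "v = s + \<pi> p v" using split[OF p] by blast
    have "trans_map E p q v = trans_map E p q s + trans_map E p q (\<pi> p v)"
      using trans_add[OF E pq, of s "\<pi> p v"] s S_E[OF p] \<pi>E[OF p v] by auto
    then show ?thesis using \<pi>add[OF q] \<pi>S[OF q S_trans[OF pq s(1)]] by simp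
  qed
  define C where "C = \<lparr>pspace = (\<lambda>p. {v \<in> pspace E p. \<pi> p v = v}),
    trans_map = (\<lambda>p q v. \<pi> q (trans_map E p q v))\<rparr>"
  have C: "v \<in> pspace C p \<longleftrightarrow> v \<in> pspace E p \<and> \<pi> p v = v" "trans_map C p q v = \<pi> q (trans_map E p q v)" for p q v
    by (auto simp: C_def)
  have \<pi>0: "\<pi> p 0 = 0" if "p \<in> Field r" for p
    using \<pi>S[OF that vec.subspace_0[OF S_sub[OF that]]] .
  have Cp: "C \<in> pmods r"
  proof (rule pmodsI)
    fix p assume p: "p \<in> Field r"
    have "vec.subspace (pspace C p)"
      unfolding vec.subspace_def
      by (auto simp: C pmods_0[OF E p] \<pi>0[OF p] pmods_add[OF E p] \<pi>add[OF p] pmods_scale[OF E p] \<pi>scale[OF p])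
    then show "fd_space (pspace C p)"
      by (rule fd_space_subspace[OF pmods_fd[OF E p]]) (auto simp: C)
    show "trans_map C p p v = v" if "v \<in> pspace C p" for v
      using that trans_id[OF E p] by (simp add: C)
  next
    fix p q v assume pq: "(p, q) \<in> r" and v: "v \<in> pspace C p"
    have p: "p \<in> Field r" and q: "q \<in> Field r" using pq by (auto intro: FieldI1 FieldI2)
    have vE: "v \<in> pspace E p" using v by (simp add: C)
    show "trans_map C p q v \<in> pspace C q"
      using \<pi>E[OF q] trans_in[OF E pq vE] \<pi>\<pi>[OF q] by (simp add: C)
    show "trans_map C p q (v + w) = trans_map C p q v + trans_map C p q w" if "w \<in> pspace C p" for w
      using that trans_add[OF E pq vE, of w] \<pi>add[OF q] by (simp add: C)
    show "trans_map C p q (\<lambda>i. c * v i) = (\<lambda>i. c * trans_map C p q v i)" for c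
      using trans_scale[OF E pq vE, of c] \<pi>scale[OF q] by (simp add: C)
    show "trans_map C q s (trans_map C p q v) = trans_map C p s v" if qs: "(q, s) \<in> r" for s
      using \<pi>trans[OF qs trans_in[OF E pq vE]] trans_comp[OF E pq qs vE] by (simp add: C)
  qed
  define P where "P = (\<lambda>p v. if p \<in> Field r \<and> v \<in> pspace E p then \<pi> p v else 0)"
  have P: "P \<in> Hom r E C"
  proof (rule HomI)
    show "P q (trans_map E p q v) = trans_map C p q (P p v)"
      if "(p, q) \<in> r" "p \<in> Field r" "q \<in> Field r" "v \<in> pspace E p" for p q v
      using that trans_in[OF E that(1,4)] \<pi>trans[OF that(1,4)] by (simp add: P_def C)
  qed (auto simp: P_def C \<pi>E \<pi>\<pi> pmods_add[OF E] pmods_scale[OF E] \<pi>add \<pi>scale)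
  have Pu: "P \<bullet> u = 0"
  proof (rule ext, rule ext)
    fix p v
    show "(P \<bullet> u) p v = (0 :: 'p \<Rightarrow> 'k vec \<Rightarrow> 'k vec) p v"
    proof (cases "p \<in> Field r \<and> v \<in> pspace U p")
      case True
      then have "u p v \<in> S p" by (simp add: S_def)
      then show ?thesis using True \<pi>S[of p "u p v"] by (simp add: hcomp_def P_def)
    next
      case False
      then show ?thesis using Hom_outside[OF u False] Hom_0[OF P] by (simp add: hcomp_def)
    qed
  qed
  have factor: "\<exists>k\<in>Hom r C M. h = k \<bullet> P" if h: "h \<in> Hom r E M" and hu: "h \<bullet> u = 0" for M h
  proof -
    have hS: "h p s = 0" if s: "s \<in> S p" for p s
    proof -
      obtain v where "s = u p v" using s by (auto simp: S_def)
      then show ?thesis using fun_cong[OF fun_cong[OF hu], of p v] by (simp add: hcomp_def)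
    qed
    have h\<pi>: "h p (\<pi> p v) = h p v" if p: "p \<in> Field r" and v: "v \<in> pspace E p" for p v
    proof -
      obtain s where s: "s \<in> S p" "v = s + \<pi> p v" using split[OF p] by blast
      have "h p (s + \<pi> p v) = h p s + h p (\<pi> p v)"
        using Hom_add[OF h p, of s "\<pi> p v"] s(1) S_E[OF p] \<pi>E[OF p v] by blast
      then show ?thesis using s(2) hS[OF s(1)] by simp
    qed
    define k where "k = (\<lambda>p v. if p \<in> Field r \<and> v \<in> pspace C p then h p v else 0)"
    have "k \<in> Hom r C M"
    proof (rule HomI)
      show "k q (trans_map C p q v) = trans_map M p q (k p v)"
        if "(p, q) \<in> r" "p \<in> Field r" "q \<in> Field r" "v \<in> pspace C p" for p q v
      proof -
        have v: "v \<in> pspace E p" using that(4) by (simp add: C)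
        have "trans_map C p q v \<in> pspace C q" using trans_in[OF Cp that(1,4)] .
        then have "k q (trans_map C p q v) = h q (\<pi> q (trans_map E p q v))"
          using that(3) by (simp add: k_def C)
        also have "\<dots> = h q (trans_map E p q v)" using h\<pi>[OF that(3) trans_in[OF E that(1) v]] .
        also have "\<dots> = trans_map M p q (k p v)"
          using Hom_natural[OF h that(1) v] that(2,4) by (simp add: k_def)
        finally show ?thesis .
      qed
    qed (auto simp: k_def C pmods_add[OF E] pmods_scale[OF E] \<pi>add \<pi>scale Hom_in[OF h] Hom_add[OF h] Hom_scale[OF h])
    moreover have "h = k \<bullet> P"
    proof (rule ext, rule ext)
      fix p v
      show "h p v = (k \<bullet> P) p v"
      proof (cases "p \<in> Field r \<and> v \<in> pspace E p")
        case True
        then have "\<pi> p v \<in> pspace C p" using \<pi>E \<pi>\<pi> by (simp add: C)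
        then show ?thesis using True h\<pi> by (simp add: hcomp_def P_def k_def)
      next
        case False
        then show ?thesis using Hom_outside[OF h False] Hom_0[OF \<open>k \<in> Hom r C M\<close>] by (auto simp: hcomp_def P_def)
      qed
    qed
    ultimately show ?thesis by blast
  qed
  have epi: "k = 0" if k: "k \<in> Hom r C M" and kP: "k \<bullet> P = 0" for M k
  proof (rule ext, rule ext)
    fix p v
    show "k p v = (0 :: 'p \<Rightarrow> 'k vec \<Rightarrow> 'k vec) p v"
    proof (cases "p \<in> Field r \<and> v \<in> pspace C p")
      case True
      then have "P p v = v" by (simp add: P_def C)
      then show ?thesis using fun_cong[OF fun_cong[OF kP], of p v] by (simp add: hcomp_def)
    qed (use Hom_outside[OF k] in simp)
  qed
  show thesis by (rule that[OF Cp P Pu]) (erule (1) factor, erule (1) epi)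
qed

section \<open>Multiplicities\<close>

text \<open>
  Let \<open>u\<close> be a homomorphism from \<open>U\<close> to \<open>E\<close> as in the lemma on left almost split maps, with cokernel \<open>C\<close>. From the exact
  sequence \<open>0 \<rightarrow> Hom(C,M) \<rightarrow> Hom(E,M) \<rightarrow> Hom(U,M)\<close> it follows that
  \<open>[U,M] - [E,M] + [C,M]\<close> is the codimension of the image of the last map. This codimension is
  zero if \<open>M\<close> is another indecomposable, as all homomorphisms factor through \<open>u\<close>, and it is
  positive for \<open>M = U\<close>, as the identity does not. Decomposing \<open>E\<close> and \<open>C\<close> turns the
  expression into a combination of the dimensions \<open>[V,M]\<close>.
\<close>

lemma counting_functional_exists:
  fixes r :: "'p rel" and U :: "('p, 'k::field) pmod"
  assumes r: "finite r" and I: "is_Ind r I" "finite I" and U: "U \<in> I"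
  obtains c :: "('p, 'k) pmod \<Rightarrow> int" where "(\<Sum>V\<in>I. c V * int (dim_Hom r V U)) > 0"
    "\<And>M. M \<in> I \<Longrightarrow> M \<noteq> U \<Longrightarrow> (\<Sum>V\<in>I. c V * int (dim_Hom r V M)) = 0"
proof -
  have Up: "U \<in> pmods r" using is_Ind_pmods[OF I(1) U] .
  obtain E u where E: "E \<in> pmods r" "u \<in> Hom r U E"
    and fact: "\<And>V h. V \<in> I \<Longrightarrow> V \<noteq> U \<Longrightarrow> h \<in> Hom r U V \<Longrightarrow> \<exists>k\<in>Hom r E V. k \<bullet> u = h"
    and nosplit: "\<And>k. k \<in> Hom r E U \<Longrightarrow> k \<bullet> u \<noteq> hid r U"
    using left_almost_split[OF r I U] by metis
  obtain C \<pi> where C: "C \<in> pmods r" "\<pi> \<in> Hom r E C" "\<pi> \<bullet> u = 0"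
    and factor: "\<And>(M :: ('p, 'k) pmod) h. h \<in> Hom r E M \<Longrightarrow> h \<bullet> u = 0 \<Longrightarrow> \<exists>k\<in>Hom r C M. h = k \<bullet> \<pi>"
    and epi: "\<And>(M :: ('p, 'k) pmod) k. k \<in> Hom r C M \<Longrightarrow> k \<bullet> \<pi> = 0 \<Longrightarrow> k = 0"
    using cokernel_exists[OF E(1) Up E(2)] by blast
  let ?im = "\<lambda>M. (\<lambda>h. h \<bullet> u) ` Hom r E M"
  have exact: "dim_Hom r E M = dim_Hom r C M + nat_trans.dim (?im M)" if M: "M \<in> pmods r" for M
  proof -
    have "{h \<in> Hom r E M. h \<bullet> u = 0} = (\<lambda>k. k \<bullet> \<pi>) ` Hom r C M"
    proof (intro equalityI subsetI)
      fix h assume "h \<in> {h \<in> Hom r E M. h \<bullet> u = 0}"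
      then show "h \<in> (\<lambda>k. k \<bullet> \<pi>) ` Hom r C M" using factor[of h M] by blast
    next
      fix h assume "h \<in> (\<lambda>k. k \<bullet> \<pi>) ` Hom r C M"
      then obtain k where k: "k \<in> Hom r C M" "h = k \<bullet> \<pi>" by blast
      then show "h \<in> {h \<in> Hom r E M. h \<bullet> u = 0}"
        using hcomp_Hom[OF k(1) C(2)] C(3) hcomp_0_right[OF k(1)] by (simp add: hcomp_assoc)
    qed
    then show ?thesis
      using dim_Hom_precomp[OF r E(1) M, of u] dim_precomp_epi[OF r C(1) M epi] by simp
  qed
  have im_sub: "?im M \<subseteq> Hom r U M" for M using hcomp_Hom[OF _ E(2)] by blast
  obtain m where m: "\<And>M. M \<in> pmods r \<Longrightarrow> int (dim_Hom r E M) = (\<Sum>V\<in>I. m V * int (dim_Hom r V M))"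
    using dim_Hom_decompose[OF r I E(1)] by blast
  obtain n where n: "\<And>M. M \<in> pmods r \<Longrightarrow> int (dim_Hom r C M) = (\<Sum>V\<in>I. n V * int (dim_Hom r V M))"
    using dim_Hom_decompose[OF r I C(1)] by blast
  define c where "c V = (if V = U then 1 else 0) - m V + n V" for V
  have sum: "(\<Sum>V\<in>I. c V * int (dim_Hom r V M)) = int (dim_Hom r U M) - int (nat_trans.dim (?im M))"
    if M: "M \<in> pmods r" for M
  proof -
    have "(\<Sum>V\<in>I. c V * int (dim_Hom r V M)) =
        (\<Sum>V\<in>I. (if V = U then int (dim_Hom r V M) else 0) - m V * int (dim_Hom r V M) + n V * int (dim_Hom r V M))"
      by (intro sum.cong) (auto simp: c_def algebra_simps)
    also have "\<dots> = int (dim_Hom r U M) - int (dim_Hom r E M) + int (dim_Hom r C M)"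
      using U I(2) by (simp add: sum.distrib sum_subtractf m[OF M] n[OF M])
    finally show ?thesis using exact[OF M] by simp
  qed
  have "(\<Sum>V\<in>I. c V * int (dim_Hom r V M)) = 0" if "M \<in> I" "M \<noteq> U" for M
  proof -
    have "?im M = Hom r U M" using im_sub fact[OF that] by blast
    then show ?thesis using sum[OF is_Ind_pmods[OF I(1) that(1)]] by (simp add: dim_Hom_def)
  qed
  moreover have "(\<Sum>V\<in>I. c V * int (dim_Hom r V U)) > 0"
  proof -
    have sub: "nat_trans.subspace (?im U)"
      unfolding nat_trans.subspace_def
    proof (intro conjI ballI allI)
      show "0 \<in> ?im U" using Hom_zero_in[OF Up, of E] hcomp_0_left[of u] by (metis image_eqI)
    next
      fix x y assume "x \<in> ?im U" "y \<in> ?im U"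
      then obtain g h where "g \<in> Hom r E U" "h \<in> Hom r E U" "x = g \<bullet> u" "y = h \<bullet> u" by blast
      then have "x + y = (g + h) \<bullet> u" "g + h \<in> Hom r E U" using Hom_plus[OF Up] by (simp_all add: hcomp_add_left)
      then show "x + y \<in> ?im U" by blast
    next
      fix c x assume "x \<in> ?im U"
      then obtain g where g: "g \<in> Hom r E U" "x = g \<bullet> u" by blast
      then have "(\<lambda>p v i. c * x p v i) = (\<lambda>p v i. c * g p v i) \<bullet> u" by (simp add: hcomp_scale_left)
      then show "(\<lambda>p v i. c * x p v i) \<in> ?im U"
        using nat_trans.subspace_scale[OF subspace_Hom[OF Up] g(1)] by (metis image_eqI)
    qed
    obtain B where B: "finite B" "Hom r U U \<subseteq> nat_trans.span B" using Hom_finite_dim[OF r Up Up] .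
    have "?im U \<noteq> Hom r U U" using hid_Hom[OF Up] nosplit by (metis (no_types, lifting) imageE)
    then have "\<not> nat_trans.dim (Hom r U U) \<le> nat_trans.dim (?im U)"
      using nat_trans.subspace_eq_if_dim_le[OF B(2,1) im_sub sub] by blast
    then show ?thesis using sum[OF Up] by (simp add: dim_Hom_def)
  qed
  ultimately show thesis using that by blast
qed

lemma dsum_power_pmods: "U \<in> pmods r \<Longrightarrow> dsum_power m U \<in> pmods r"
  by (induct m) (simp_all add: zero_pmod dsum_pmods)

lemma dsum_power_add:
  assumes U: "U \<in> pmods r"
  shows "pmod_iso r (dsum (dsum_power m U) (dsum_power n U)) (dsum_power (m + n) U)"
proof (induct m)
  case 0
  then show ?case using pmod_iso_sym[OF dsum_zero_left[OF dsum_power_pmods[OF U]]] by simp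
next
  case (Suc m)
  note pw = dsum_power_pmods[OF U]
  have "pmod_iso r (dsum (dsum_power (Suc m) U) (dsum_power n U)) (dsum U (dsum (dsum_power m U) (dsum_power n U)))"
    using dsum_assoc[OF U pw pw] by simp
  moreover have "pmod_iso r (dsum U (dsum (dsum_power m U) (dsum_power n U))) (dsum U (dsum_power (m + n) U))"
    using dsum_cong[OF U dsum_pmods[OF pw pw] U pw pmod_iso_refl[OF U] Suc] .
  ultimately show ?case using pmod_iso_trans by simp blast
qed

lemma dsum_interchange:
  assumes A: "A \<in> pmods r" and B: "B \<in> pmods r" and C: "C \<in> pmods r" and D: "D \<in> pmods r"
  shows "pmod_iso r (dsum (dsum A B) (dsum C D)) (dsum (dsum A C) (dsum B D))"
proof -
  note pm = dsum_pmods[OF B C] dsum_pmods[OF C B] dsum_pmods[OF B D] dsum_pmods[OF C D]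
  have "pmod_iso r (dsum B (dsum C D)) (dsum (dsum B C) D)"
    using pmod_iso_sym[OF dsum_assoc[OF B C D]] .
  moreover have "pmod_iso r (dsum (dsum B C) D) (dsum (dsum C B) D)"
    using dsum_cong[OF pm(1) D pm(2) D dsum_comm[OF B C] pmod_iso_refl[OF D]] .
  moreover have "pmod_iso r (dsum (dsum C B) D) (dsum C (dsum B D))"
    using dsum_assoc[OF C B D] .
  ultimately have "pmod_iso r (dsum B (dsum C D)) (dsum C (dsum B D))"
    using pmod_iso_trans by blast
  then have "pmod_iso r (dsum A (dsum B (dsum C D))) (dsum A (dsum C (dsum B D)))"
    using dsum_cong[OF A dsum_pmods[OF B pm(4)] A dsum_pmods[OF C pm(3)] pmod_iso_refl[OF A]] by blast
  then show ?thesis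
    using dsum_assoc[OF A B pm(4)] pmod_iso_sym[OF dsum_assoc[OF A C pm(3)]] pmod_iso_trans by blast
qed

text \<open>
  The Krull-Schmidt theorem in numerical form. An additive \<open>g\<close> that is zero on all indecomposables
  but \<^term>\<open>U\<close> counts the summands isomorphic to \<^term>\<open>U\<close>: a decomposition
  of \<^term>\<open>M\<close> with \<open>m\<close> copies of \<^term>\<open>U\<close> and a remainder on which \<open>g\<close> vanishes exists, and since \<open>g\<close> is
  nonnegative, no decomposition has more copies.
\<close>

lemma summand_mult_eq:
  fixes r :: "'p rel" and U :: "('p, 'k::field) pmod"
  assumes r: "finite r" and I: "is_Ind r I" and U: "U \<in> I"
    and g: "additive_on_pmods r g" "g U > 0" "\<And>V. V \<in> I \<Longrightarrow> V \<noteq> U \<Longrightarrow> g V = 0"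
    and M: "M \<in> pmods r"
  shows "g U * int (summand_mult r U M) = g M"
proof -
  have Up: "U \<in> pmods r" using is_Ind_pmods[OF I U] .
  note pw = dsum_power_pmods[OF Up]
  have gpw: "g (dsum_power m U) = int m * g U" for m
    by (induct m) (simp_all add: additive_zero[OF g(1)] additive_dsum[OF g(1) Up pw] algebra_simps)
  have nonneg: "g N \<ge> 0" if "N \<in> pmods r" for N
    using additive_nonneg[OF r I g(1) _ that] g(2,3) by (metis order.refl order.strict_implies_order)
  have "\<exists>m. \<exists>N\<in>pmods r. pmod_iso r M (dsum (dsum_power m U) N) \<and> g N = 0"
    using r M
  proof (induct rule: pmod_induct)
    case (iso M N)
    then show ?case using pmod_iso_trans by blast
  next
    case zero
    have "pmod_iso r zero_pmod (dsum (dsum_power 0 U) zero_pmod)"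
      using dsum_zero_left[OF zero_pmod] by simp
    then show ?case using zero_pmod additive_zero[OF g(1)] by blast
  next
    case (indecomposable V)
    then obtain W where W: "W \<in> I" "pmod_iso r V W" using is_Ind_obtain[OF I] by blast
    have V: "V \<in> pmods r" using indecomposable by (simp add: indecomposables_def)
    show ?case
    proof (cases "W = U")
      case True
      have "pmod_iso r V (dsum U zero_pmod)"
        using pmod_iso_trans[OF W(2)] dsum_zero_right[OF Up] True by simp
      then have "pmod_iso r V (dsum (dsum U zero_pmod) zero_pmod)"
        using pmod_iso_trans dsum_zero_right[OF dsum_pmods[OF Up zero_pmod]] by blast
      then have "pmod_iso r V (dsum (dsum_power (Suc 0) U) zero_pmod)" by simp
      then show ?thesis using zero_pmod additive_zero[OF g(1)] by blast
    next
      case False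
      have "pmod_iso r V (dsum (dsum_power 0 U) V)" using dsum_zero_left[OF V] by simp
      moreover have "g V = 0"
        using g(3)[OF W(1) False] additive_iso[OF g(1) V is_Ind_pmods[OF I W(1)] W(2)] by simp
      ultimately show ?thesis using V by blast
    qed
  next
    case (dsum M N)
    obtain m M' where M': "M' \<in> pmods r" "pmod_iso r M (dsum (dsum_power m U) M')" "g M' = 0"
      using dsum(3) by blast
    obtain n N' where N': "N' \<in> pmods r" "pmod_iso r N (dsum (dsum_power n U) N')" "g N' = 0"
      using dsum(4) by blast
    note pmM = dsum_pmods[OF pw[of m] M'(1)] and pmN = dsum_pmods[OF pw[of n] N'(1)]
      and pmMN = dsum_pmods[OF M'(1) N'(1)]
    have "pmod_iso r (dsum M N) (dsum (dsum (dsum_power m U) M') (dsum (dsum_power n U) N'))"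
      using dsum_cong[OF dsum(1,2) pmM pmN M'(2) N'(2)] .
    moreover have "pmod_iso r (dsum (dsum (dsum_power m U) M') (dsum (dsum_power n U) N'))
        (dsum (dsum (dsum_power m U) (dsum_power n U)) (dsum M' N'))"
      using dsum_interchange[OF pw M'(1) pw N'(1)] .
    moreover have "pmod_iso r (dsum (dsum (dsum_power m U) (dsum_power n U)) (dsum M' N'))
        (dsum (dsum_power (m + n) U) (dsum M' N'))"
      using dsum_cong[OF dsum_pmods[OF pw pw] pmMN pw pmMN dsum_power_add[OF Up] pmod_iso_refl[OF pmMN]] .
    ultimately have "pmod_iso r (dsum M N) (dsum (dsum_power (m + n) U) (dsum M' N'))"
      using pmod_iso_trans by blast
    moreover have "g (dsum M' N') = 0" using additive_dsum[OF g(1) M'(1) N'(1)] M'(3) N'(3) by simp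
    ultimately show ?case using pmMN by blast
  qed
  then obtain m N where N: "N \<in> pmods r" "pmod_iso r M (dsum (dsum_power m U) N)" "g N = 0" by blast
  have gM: "g M = int n * g U + g N'" if "N' \<in> pmods r" "pmod_iso r M (dsum (dsum_power n U) N')" for n N'
    using additive_iso[OF g(1) M dsum_pmods[OF pw that(1)] that(2)] additive_dsum[OF g(1) pw that(1)] gpw
    by simp
  have "summand_mult r U M = m"
    unfolding summand_mult_def
  proof (rule Greatest_equality)
    show "\<exists>N\<in>pmods r. pmod_iso r M (dsum (dsum_power m U) N)" using N by blast
    fix n assume "\<exists>N'\<in>pmods r. pmod_iso r M (dsum (dsum_power n U) N')"
    then obtain N' where N': "N' \<in> pmods r" "pmod_iso r M (dsum (dsum_power n U) N')" by blast
    have "int n * g U \<le> int m * g U" using gM[OF N'] gM[OF N(1,2)] N(3) nonneg[OF N'(1)] by simp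
    then show "n \<le> m" using g(2) by simp
  qed
  then show ?thesis using gM[OF N(1,2)] N(3) by simp
qed

lemma mult_from_dim_Hom:
  assumes r: "finite r" and I: "is_Ind r I" "finite I" and U: "U \<in> I"
  obtains e c where "e > 0"
    "\<And>M. M \<in> pmods r \<Longrightarrow> e * int (summand_mult r U M) = (\<Sum>V\<in>I. c V * int (dim_Hom r V M))"
    "\<And>V. V \<in> I \<Longrightarrow> summand_mult r U V = (if V = U then 1 else 0)"
proof -
  obtain c where c: "(\<Sum>V\<in>I. c V * int (dim_Hom r V U)) > 0"
    "\<And>M. M \<in> I \<Longrightarrow> M \<noteq> U \<Longrightarrow> (\<Sum>V\<in>I. c V * int (dim_Hom r V M)) = 0"
    using counting_functional_exists[OF r I U] by blast
  define g where "g M = (\<Sum>V\<in>I. c V * int (dim_Hom r V M))" for M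
  have g: "additive_on_pmods r g"
    unfolding g_def[abs_def] using additive_dim_Hom[OF r is_Ind_pmods[OF I(1)]] by (rule additive_lincomb)
  have eq: "g U * int (summand_mult r U M) = g M" if "M \<in> pmods r" for M
    using summand_mult_eq[OF r I(1) U g _ _ that] c by (simp add: g_def)
  have pos: "g U > 0" and 0: "\<And>V. V \<in> I \<Longrightarrow> V \<noteq> U \<Longrightarrow> g V = 0" using c by (simp_all add: g_def)
  have "summand_mult r U V = (if V = U then 1 else 0)" if "V \<in> I" for V
    using eq[OF is_Ind_pmods[OF I(1) that]] pos 0[OF that] by (cases "V = U") auto
  then show thesis using that[OF pos] eq by (simp add: g_def)
qed

lemma additive_summand_mult:
  fixes U :: "('p, 'k::field) pmod"
  assumes r: "finite r" and I: "is_Ind r I" "finite I" and U: "U \<in> I"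
  shows "additive_on_pmods r (\<lambda>M. int (summand_mult r U M))"
proof -
  obtain e c where e: "(e::int) > 0"
    "\<And>M. M \<in> pmods r \<Longrightarrow> e * int (summand_mult r U M) = (\<Sum>V\<in>I. c V * int (dim_Hom r V M))"
    using mult_from_dim_Hom[OF r I U] by metis
  define g where "g M = (\<Sum>V\<in>I. c V * int (dim_Hom r V M))" for M
  have g: "additive_on_pmods r g"
    unfolding g_def[abs_def] using additive_dim_Hom[OF r is_Ind_pmods[OF I(1)]] by (rule additive_lincomb)
  have eq: "e * int (summand_mult r U M) = g M" if "M \<in> pmods r" for M using e(2)[OF that] by (simp add: g_def)
  show ?thesis
    unfolding additive_on_pmods_def
  proof (intro conjI ballI impI)
    fix M N :: "('p, 'k) pmod" assume MN: "M \<in> pmods r" "N \<in> pmods r"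
    have "e * int (summand_mult r U (dsum M N)) = e * (int (summand_mult r U M) + int (summand_mult r U N))"
      using eq[OF MN(1)] eq[OF MN(2)] eq[OF dsum_pmods[OF MN]] additive_dsum[OF g MN]
      by (simp add: distrib_left)
    then show "int (summand_mult r U (dsum M N)) = int (summand_mult r U M) + int (summand_mult r U N)"
      using e(1) by (metis mult_cancel_left less_irrefl)
    assume "pmod_iso r M N"
    then have "e * int (summand_mult r U M) = e * int (summand_mult r U N)"
      using eq[OF MN(1)] eq[OF MN(2)] additive_iso[OF g MN] by simp
    then show "int (summand_mult r U M) = int (summand_mult r U N)" using e(1) by simp
  qed
qed

text \<open>
  Both sides are additive in \<^term>\<open>M\<close>, and on an indecomposable exactly one multiplicity is nonzero.
\<close>

lemma dim_Hom_from_mult: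
  fixes U :: "('p, 'k::field) pmod"
  assumes r: "finite r" and I: "is_Ind r I" "finite I" and U: "U \<in> pmods r" and M: "M \<in> pmods r"
  shows "int (dim_Hom r U M) = (\<Sum>V\<in>I. int (dim_Hom r U V) * int (summand_mult r V M))"
proof (rule additive_eqI[OF r I(1) additive_dim_Hom[OF r U] _ _ M])
  show "additive_on_pmods r (\<lambda>M. \<Sum>V\<in>I. int (dim_Hom r U V) * int (summand_mult r V M))"
    using additive_summand_mult[OF r I] by (rule additive_lincomb)
  fix W assume W: "W \<in> I"
  have "summand_mult r V W = (if V = W then 1 else 0)" if V: "V \<in> I" for V
    using mult_from_dim_Hom[OF r I V] W by metis
  then have "(\<Sum>V\<in>I. int (dim_Hom r U V) * int (summand_mult r V W)) =
      (\<Sum>V\<in>I. if V = W then int (dim_Hom r U V) else 0)"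
    by (intro sum.cong) auto
  then show "int (dim_Hom r U W) = (\<Sum>V\<in>I. int (dim_Hom r U V) * int (summand_mult r V W))"
    using W I(2) by simp
qed

section \<open>The split Grothendieck group\<close>

lemma group_free_isoclasses: "comm_group (free_isoclasses r)"
  by (simp add: free_isoclasses_def abelian_free_Abelian_group)

lemma frag_of_isoclass: "M \<in> pmods r \<Longrightarrow> frag_of (isoclass r M) \<in> carrier (free_isoclasses r)"
  by (simp add: free_isoclasses_def)

lemma split_relations_carrier:
  "{frag_of (isoclass r (dsum M N)) - (frag_of (isoclass r M) + frag_of (isoclass r N)) |M N.
     M \<in> pmods r \<and> N \<in> pmods r} \<subseteq> carrier (free_isoclasses r)"
proof -
  have "frag_of (isoclass r (dsum M N)) - (frag_of (isoclass r M) + frag_of (isoclass r N))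
      \<in> carrier (free_isoclasses r)" if MN: "M \<in> pmods r" "N \<in> pmods r" for M N
  proof -
    have "Poly_Mapping.keys (frag_of (isoclass r M) + frag_of (isoclass r N)) \<subseteq> isoclass r ` pmods r"
      using MN by (intro order_trans[OF keys_add]) auto
    then show ?thesis unfolding free_isoclasses_def
      using MN dsum_pmods[OF MN] keys_diff[of "frag_of (isoclass r (dsum M N))"] by fastforce
  qed
  then show ?thesis by blast
qed

lemma normal_split_relations: "split_relations r \<lhd> free_isoclasses r"
proof -
  interpret comm_group "free_isoclasses r" by (rule group_free_isoclasses)
  show ?thesis unfolding split_relations_def
    using subgroup_imp_normal generate_is_subgroup[OF split_relations_carrier] by blast
qed

lemma group_K0sp: "group (K0sp r)"
  unfolding K0sp_def using normal.factorgroup_is_group[OF normal_split_relations] .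

text \<open>
  The classes of modules generate the split Grothendieck group.
\<close>

lemma K0_hom_eqI:
  fixes \<Phi> :: "(('p, 'k::field) pmod set \<Rightarrow>\<^sub>0 int) set \<Rightarrow> 'h"
  assumes H: "group H" and \<Phi>: "\<Phi> \<in> hom (K0sp r) H" and \<Psi>: "\<Psi> \<in> hom (K0sp r) H"
    and eq: "\<And>M. M \<in> pmods r \<Longrightarrow> \<Phi> (K0_class r M) = \<Psi> (K0_class r M)"
    and c: "c \<in> carrier (K0sp r)"
  shows "\<Phi> c = \<Psi> c"
proof -
  interpret H: group H by (rule H)
  define q where "q x = split_relations r #>\<^bsub>free_isoclasses r\<^esub> x"
    for x :: "('p, 'k) pmod set \<Rightarrow>\<^sub>0 int"
  have q: "q \<in> hom (free_isoclasses r) (K0sp r)"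
    unfolding q_def K0sp_def using normal.r_coset_hom_Mod[OF normal_split_relations] .
  obtain x where x: "x \<in> carrier (free_isoclasses r)" "c = q x"
    using c by (auto simp: K0sp_def carrier_FactGroup q_def)
  have hom: "h \<in> hom (free_Abelian_group (isoclass r ` pmods r)) H \<and> (\<lambda>x. h x) = (\<lambda>x. \<Theta> (q x))"
    if "\<Theta> \<in> hom (K0sp r) H" "h = \<Theta> \<circ> q" for \<Theta> h
    using Group.hom_compose[OF q that(1)] that(2) by (simp add: free_isoclasses_def comp_def)
  have keys: "Poly_Mapping.keys x \<subseteq> isoclass r ` pmods r" using x(1) by (simp add: free_isoclasses_def)
  have "\<Phi> (q x) = \<Psi> (q x)"
  proof (rule free_Abelian_group_induct[OF keys, where P = "\<lambda>x. \<Phi> (q x) = \<Psi> (q x)"])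
    have "q 0 = \<one>\<^bsub>K0sp r\<^esub>"
      using hom_one[OF q comm_group.axioms(2)[OF group_free_isoclasses] group_K0sp]
      by (simp add: free_isoclasses_def)
    then show "\<Phi> (q 0) = \<Psi> (q 0)" using hom_one[OF \<Phi> group_K0sp H] hom_one[OF \<Psi> group_K0sp H] by simp
  next
    fix x y :: "('p, 'k) pmod set \<Rightarrow>\<^sub>0 int"
    assume 2: "Poly_Mapping.keys x \<subseteq> isoclass r ` pmods r" "Poly_Mapping.keys y \<subseteq> isoclass r ` pmods r"
      "\<Phi> (q x) = \<Psi> (q x)" "\<Phi> (q y) = \<Psi> (q y)"
    let ?G = "free_Abelian_group (isoclass r ` pmods r)"
    have in_car: "x - y \<in> carrier ?G" "y \<in> carrier ?G"
      using 2(1,2) keys_diff[of x y] by auto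
    have \<Theta>: "\<Theta> (q x) = \<Theta> (q (x - y)) \<otimes>\<^bsub>H\<^esub> \<Theta> (q y)" if "\<Theta> \<in> hom (K0sp r) H" for \<Theta>
      using hom_mult[OF conjunct1[OF hom[OF that refl]] in_car] by simp
    have car: "\<Theta> (q z) \<in> carrier H" if "\<Theta> \<in> hom (K0sp r) H" "z \<in> carrier ?G" for \<Theta> z
      using hom_in_carrier[OF conjunct1[OF hom[OF that(1) refl]] that(2)] by simp
    have "\<Phi> (q (x - y)) \<otimes>\<^bsub>H\<^esub> \<Phi> (q y) = \<Psi> (q (x - y)) \<otimes>\<^bsub>H\<^esub> \<Phi> (q y)"
      using \<Theta>[OF \<Phi>] \<Theta>[OF \<Psi>] 2(3,4) by simp
    then show "\<Phi> (q (x - y)) = \<Psi> (q (x - y))" using car[OF \<Phi>] car[OF \<Psi>] in_car by simp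
  next
    fix a :: "('p, 'k) pmod set" assume "a \<in> isoclass r ` pmods r"
    then show "\<Phi> (q (frag_of a)) = \<Psi> (q (frag_of a))" using eq by (auto simp: K0_class_def q_def)
  qed
  then show ?thesis using x(2) by simp
qed

lemma K0_class_in_carrier: "M \<in> pmods r \<Longrightarrow> K0_class r M \<in> carrier (K0sp r)"
  using frag_of_isoclass[of M r] by (auto simp: K0_class_def K0sp_def carrier_FactGroup)

lemma comm_group_int_power: "comm_group (int_power J)"
  by (rule group.group_comm_groupI) (auto simp: add.commute)

text \<open>
  Existence is the universal property of the free abelian group, followed by that of the
  quotient: additivity says that the relations are sent to zero. Uniqueness
  is the previous lemma.
\<close>

lemma K0_extend_additive:
  fixes \<phi> :: "('p, 'k::field) pmod \<Rightarrow> 'j \<Rightarrow> int"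
  assumes add: "\<And>j. j \<in> J \<Longrightarrow> additive_on_pmods r (\<lambda>M. \<phi> M j)"
  shows "K0_extend r J \<phi> \<in> hom (K0sp r) (int_power J)"
    and "\<And>M. M \<in> pmods r \<Longrightarrow> K0_extend r J \<phi> (K0_class r M) = restrict (\<phi> M) J"
proof -
  interpret H: comm_group "int_power J" by (rule comm_group_int_power)
  interpret G: comm_group "free_isoclasses r :: (('p, 'k) pmod set \<Rightarrow>\<^sub>0 int) monoid" by (rule group_free_isoclasses)
  define f where "f c = restrict (\<phi> (SOME M. M \<in> c)) J" for c :: "('p, 'k) pmod set"
  have f: "f (isoclass r M) = restrict (\<phi> M) J" if M: "M \<in> pmods r" for M
  proof -
    have "M \<in> isoclass r M" using pmod_iso_refl[OF M] M by (simp add: isoclass_def)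
    then have "(SOME N. N \<in> isoclass r M) \<in> isoclass r M" by (rule someI)
    then have N: "(SOME N. N \<in> isoclass r M) \<in> pmods r" "pmod_iso r M (SOME N. N \<in> isoclass r M)"
      by (simp_all add: isoclass_def)
    have "\<phi> (SOME N. N \<in> isoclass r M) j = \<phi> M j" if "j \<in> J" for j
      using additive_iso[OF add[OF that] M N] by simp
    then show ?thesis unfolding f_def by (intro restrict_ext)
  qed
  have "f ` isoclass r ` pmods r \<subseteq> carrier (int_power J)" using f by auto
  then obtain h where h: "h \<in> hom (free_isoclasses r) (int_power J)"
    "\<And>x. x \<in> isoclass r ` pmods r \<Longrightarrow> h (frag_of x) = f x"
    unfolding free_isoclasses_def using H.free_Abelian_group_universal by metis
  interpret h: group_hom "free_isoclasses r" "int_power J" h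
    by unfold_locales (rule h)
  have hM: "h (frag_of (isoclass r M)) = restrict (\<phi> M) J" if "M \<in> pmods r" for M
    using h(2) f[OF that] that by simp
  have rel: "x \<in> kernel (free_isoclasses r) (int_power J) h"
    if xR: "x \<in> {frag_of (isoclass r (dsum M N)) - (frag_of (isoclass r M) + frag_of (isoclass r N)) |M N.
      M \<in> pmods r \<and> N \<in> pmods r}" for x
  proof -
    have xc: "x \<in> carrier (free_isoclasses r)" using xR split_relations_carrier[of r] by blast
    obtain M N where x: "x = frag_of (isoclass r (dsum M N)) - (frag_of (isoclass r M) + frag_of (isoclass r N))"
      and MN: "M \<in> pmods r" "N \<in> pmods r" using xR by blast
    let ?m = "frag_of (isoclass r M)" and ?n = "frag_of (isoclass r N)"
    note car = frag_of_isoclass[OF MN(1)] frag_of_isoclass[OF MN(2)]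
    have mn: "?m \<otimes>\<^bsub>free_isoclasses r\<^esub> ?n = ?m + ?n" "x \<otimes>\<^bsub>free_isoclasses r\<^esub> (?m + ?n) = frag_of (isoclass r (dsum M N))"
      by (simp_all add: free_isoclasses_def x)
    have "h (?m + ?n) = restrict (\<phi> (dsum M N)) J"
      using h.hom_mult[OF car] hM[OF MN(1)] hM[OF MN(2)] additive_dsum[OF add MN] mn(1)
      by (auto intro!: restrict_ext)
    also have "\<dots> = h (x \<otimes>\<^bsub>free_isoclasses r\<^esub> (?m + ?n))"
      using hM[OF dsum_pmods[OF MN]] mn(2) by simp
    also have "\<dots> = h x \<otimes>\<^bsub>int_power J\<^esub> h (?m + ?n)"
      using h.hom_mult[OF xc] G.m_closed[OF car] mn(1) by simp
    finally have "h x = \<one>\<^bsub>int_power J\<^esub>"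
      using H.r_cancel_one'[of "h (?m + ?n)" "h x"] h.hom_closed[OF xc] h.hom_closed[OF G.m_closed[OF car]] mn(1)
      by metis
    then show ?thesis using xc by (simp add: kernel_def)
  qed
  have "split_relations r \<subseteq> kernel (free_isoclasses r) (int_power J) h"
    unfolding split_relations_def
    by (rule G.generate_subgroup_incl[OF _ h.subgroup_kernel]) (use rel in blast)
  then obtain g where g: "g \<in> hom (K0sp r) (int_power J)"
    "\<And>x. x \<in> carrier (free_isoclasses r) \<Longrightarrow> g (split_relations r #>\<^bsub>free_isoclasses r\<^esub> x) = h x"
    using h.FactGroup_universal_kernel[OF normal_split_relations] unfolding K0sp_def by metis
  define \<Phi> where "\<Phi> = restrict g (carrier (K0sp r))"
  have gM: "g (K0_class r M) = restrict (\<phi> M) J" if "M \<in> pmods r" for M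
    using g(2)[OF frag_of_isoclass[OF that]] hM[OF that] by (simp add: K0_class_def)
  have "group (K0sp r :: (('p, 'k) pmod set \<Rightarrow>\<^sub>0 int) set monoid)" by (rule group_K0sp)
  then have \<Phi>hom: "\<Phi> \<in> hom (K0sp r) (int_power J)"
    using g(1) by (auto simp: \<Phi>_def hom_def Pi_iff group.is_monoid monoid.m_closed)
  have \<Phi>M: "\<Phi> (K0_class r M) = restrict (\<phi> M) J" if "M \<in> pmods r" for M
    using gM[OF that] K0_class_in_carrier[OF that] by (simp add: \<Phi>_def)
  have "K0_extend r J \<phi> = \<Phi>"
    unfolding K0_extend_def
  proof (rule the_equality)
    show "\<Phi> \<in> extensional (carrier (K0sp r)) \<and> \<Phi> \<in> hom (K0sp r) (int_power J) \<and>
        (\<forall>M\<in>pmods r. \<Phi> (K0_class r M) = restrict (\<phi> M) J)"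
      using \<Phi>hom \<Phi>M by (simp add: \<Phi>_def)
    fix \<Psi> assume \<Psi>: "\<Psi> \<in> extensional (carrier (K0sp r)) \<and> \<Psi> \<in> hom (K0sp r) (int_power J) \<and>
        (\<forall>M\<in>pmods r. \<Psi> (K0_class r M) = restrict (\<phi> M) J)"
    show "\<Psi> = \<Phi>"
    proof (rule extensionalityI[of _ "carrier (K0sp r)"])
      show "\<Psi> c = \<Phi> c" if "c \<in> carrier (K0sp r)" for c
        using K0_hom_eqI[OF H.is_group _ \<Phi>hom _ that] \<Psi> \<Phi>M by simp
    qed (use \<Psi> in \<open>simp_all add: \<Phi>_def\<close>)
  qed
  then show "K0_extend r J \<phi> \<in> hom (K0sp r) (int_power J)"
    and "\<And>M. M \<in> pmods r \<Longrightarrow> K0_extend r J \<phi> (K0_class r M) = restrict (\<phi> M) J"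
    using \<Phi>hom \<Phi>M by simp_all
qed

text \<open>
  If two homomorphisms identify the same elements, then sending a value of one to the value of the
  other at the same element is well defined and injective.
\<close>

lemma equivalent_invariants_if_same_fibres:
  assumes \<Phi>: "\<Phi> \<in> hom (K0sp r) (int_power J1)" and \<Psi>: "\<Psi> \<in> hom (K0sp r) (int_power J2)"
    and fib: "\<And>c d. c \<in> carrier (K0sp r) \<Longrightarrow> d \<in> carrier (K0sp r) \<Longrightarrow> \<Phi> c = \<Phi> d \<longleftrightarrow> \<Psi> c = \<Psi> d"
  shows "equivalent_invariants r J1 \<Phi> J2 \<Psi>"
proof -
  interpret K: group "K0sp r" by (rule group_K0sp)
  define \<theta> where "\<theta> y = \<Psi> (SOME c. c \<in> carrier (K0sp r) \<and> \<Phi> c = y)" for y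
  have \<theta>: "\<theta> (\<Phi> c) = \<Psi> c" if "c \<in> carrier (K0sp r)" for c
  proof -
    have "\<exists>d. d \<in> carrier (K0sp r) \<and> \<Phi> d = \<Phi> c" using that by blast
    then have "(SOME d. d \<in> carrier (K0sp r) \<and> \<Phi> d = \<Phi> c) \<in> carrier (K0sp r) \<and>
        \<Phi> (SOME d. d \<in> carrier (K0sp r) \<and> \<Phi> d = \<Phi> c) = \<Phi> c" by (rule someI_ex)
    then show ?thesis unfolding \<theta>_def using fib that by blast
  qed
  have "\<theta> \<in> iso ((int_power J1)\<lparr>carrier := \<Phi> ` carrier (K0sp r)\<rparr>) ((int_power J2)\<lparr>carrier := \<Psi> ` carrier (K0sp r)\<rparr>)"
  proof (rule isoI)
    show "\<theta> \<in> hom ((int_power J1)\<lparr>carrier := \<Phi> ` carrier (K0sp r)\<rparr>) ((int_power J2)\<lparr>carrier := \<Psi> ` carrier (K0sp r)\<rparr>)"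
    proof (rule homI)
      fix x assume "x \<in> carrier ((int_power J1)\<lparr>carrier := \<Phi> ` carrier (K0sp r)\<rparr>)"
      then show "\<theta> x \<in> carrier ((int_power J2)\<lparr>carrier := \<Psi> ` carrier (K0sp r)\<rparr>)" using \<theta> by auto
    next
      fix x y
      assume "x \<in> carrier ((int_power J1)\<lparr>carrier := \<Phi> ` carrier (K0sp r)\<rparr>)"
        "y \<in> carrier ((int_power J1)\<lparr>carrier := \<Phi> ` carrier (K0sp r)\<rparr>)"
      then obtain c d where c: "c \<in> carrier (K0sp r)" "d \<in> carrier (K0sp r)" "x = \<Phi> c" "y = \<Phi> d" by auto
      have "\<theta> (x \<otimes>\<^bsub>int_power J1\<^esub> y) = \<theta> (\<Phi> (c \<otimes>\<^bsub>K0sp r\<^esub> d))"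
        using hom_mult[OF \<Phi> c(1,2)] c by simp
      also have "\<dots> = \<Psi> c \<otimes>\<^bsub>int_power J2\<^esub> \<Psi> d"
        using \<theta>[OF K.m_closed[OF c(1,2)]] hom_mult[OF \<Psi> c(1,2)] by simp
      finally show "\<theta> (x \<otimes>\<^bsub>(int_power J1)\<lparr>carrier := \<Phi> ` carrier (K0sp r)\<rparr>\<^esub> y) =
          \<theta> x \<otimes>\<^bsub>(int_power J2)\<lparr>carrier := \<Psi> ` carrier (K0sp r)\<rparr>\<^esub> \<theta> y"
        using \<theta> c by simp
    qed
    show "bij_betw \<theta> (carrier ((int_power J1)\<lparr>carrier := \<Phi> ` carrier (K0sp r)\<rparr>))
        (carrier ((int_power J2)\<lparr>carrier := \<Psi> ` carrier (K0sp r)\<rparr>))"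
      unfolding bij_betw_def using \<theta> fib by (auto simp: inj_on_def image_iff)
  qed
  then show ?thesis unfolding equivalent_invariants_def invariant_on_def using \<Phi> \<Psi> \<theta> by blast
qed

section \<open>Restriction along order-embeddings\<close>

lemma restrict_along_pmods:
  assumes f: "f \<in> order_embeddings X P" and M: "M \<in> pmods P"
  shows "restrict_along f M \<in> pmods X"
proof -
  have fx: "f x \<in> Field P" if "x \<in> Field X" for x using f that by (auto simp: order_embeddings_def)
  have fxy: "(f x, f y) \<in> P" if "(x, y) \<in> X" for x y
    using f that by (auto simp: order_embeddings_def intro: FieldI1 FieldI2)
  show ?thesis
    by (rule pmodsI) (auto simp: restrict_along_def pmods_fd[OF M] fx trans_in[OF M fxy] trans_add[OF M fxy]
        trans_scale[OF M fxy] trans_id[OF M] trans_comp[OF M fxy fxy])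
qed

lemma restrict_along_dsum: "restrict_along f (dsum M N) = dsum (restrict_along f M) (restrict_along f N)"
  by (simp add: restrict_along_def dsum_def)

lemma restrict_along_iso:
  assumes f: "f \<in> order_embeddings X P" and iso: "pmod_iso P M N"
  shows "pmod_iso X (restrict_along f M) (restrict_along f N)"
proof -
  have fx: "f x \<in> Field P" if "x \<in> Field X" for x using f that by (auto simp: order_embeddings_def)
  have fxy: "(f x, f y) \<in> P" if "(x, y) \<in> X" for x y
    using f that by (auto simp: order_embeddings_def intro: FieldI1 FieldI2)
  obtain g h where g: "g \<in> Hom P M N" and h: "h \<in> Hom P N M"
    and inv: "\<forall>p\<in>Field P. (\<forall>v\<in>pspace M p. h p (g p v) = v) \<and> (\<forall>w\<in>pspace N p. g p (h p w) = w)"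
    using iso unfolding pmod_iso_def by blast
  define R where "R k = (\<lambda>x v. if x \<in> Field X then k (f x) v else 0)" for k :: "'b \<Rightarrow> 'c vec \<Rightarrow> 'c vec"
  have R: "R k \<in> Hom X (restrict_along f M) (restrict_along f N)" if k: "k \<in> Hom P M N" for k M N
    by (rule HomI) (auto simp: R_def restrict_along_def fx Hom_in[OF k] Hom_add[OF k] Hom_scale[OF k]
        Hom_natural[OF k fxy] Hom_outside[OF k])
  have "\<forall>x\<in>Field X. (\<forall>v\<in>pspace (restrict_along f M) x. R h x (R g x v) = v) \<and>
      (\<forall>w\<in>pspace (restrict_along f N) x. R g x (R h x w) = w)"
    using inv fx by (simp add: R_def restrict_along_def)
  then show ?thesis unfolding pmod_iso_def using R[OF g] R[OF h] by blast
qed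

lemma additive_restrict_along:
  assumes f: "f \<in> order_embeddings X P" and \<phi>: "additive_on_pmods X \<phi>"
  shows "additive_on_pmods P (\<lambda>M. \<phi> (restrict_along f M))"
  unfolding additive_on_pmods_def
  using additive_iso[OF \<phi> restrict_along_pmods[OF f] restrict_along_pmods[OF f] restrict_along_iso[OF f]]
    additive_dsum[OF \<phi> restrict_along_pmods[OF f] restrict_along_pmods[OF f]]
  by (simp add: restrict_along_dsum)

text \<open>
  Two sets of representatives of the indecomposables are in bijection.
\<close>

lemma is_Ind_finite:
  fixes I :: "('p, 'k::field) pmod set"
  assumes "rep_finite TYPE('k) r" and I: "is_Ind r I"
  shows "finite I"
proof -
  obtain I' :: "('p, 'k) pmod set" where I': "is_Ind r I'" "finite I'"
    using assms(1) unfolding rep_finite_def by blast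
  have "\<forall>U\<in>I. \<exists>V\<in>I'. pmod_iso r U V"
    using is_Ind_obtain[OF I'(1)] is_Ind_indecomposable[OF I] by metis
  then obtain f where f: "\<And>U. U \<in> I \<Longrightarrow> f U \<in> I' \<and> pmod_iso r U (f U)" by metis
  have "inj_on f I"
  proof (rule inj_onI)
    fix U V assume UV: "U \<in> I" "V \<in> I" "f U = f V"
    then have "pmod_iso r U V" using f pmod_iso_sym pmod_iso_trans by metis
    then show "U = V" using is_Ind_unique[OF I UV(1,2)] by blast
  qed
  then show ?thesis using f I'(2) by (metis finite_imageD finite_subset image_subsetI)
qed

section \<open>The equivalence\<close>

lemma hom_component:
  assumes \<Phi>: "\<Phi> \<in> hom K (int_power J)" and cd: "c \<in> carrier K" "d \<in> carrier K" and j: "j \<in> J"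
  shows "\<Phi> (c \<otimes>\<^bsub>K\<^esub> d) j = \<Phi> c j + \<Phi> d j"
  using hom_mult[OF \<Phi> cd] j by simp

lemma lincomb_of_components_hom:
  assumes \<Phi>: "\<Phi> \<in> hom K (int_power J)" and j: "\<And>i. i \<in> I \<Longrightarrow> j i \<in> J"
  shows "(\<lambda>c. \<Sum>i\<in>I. a i * \<Phi> c (j i)) \<in> hom K integer_group"
  by (rule homI) (simp_all add: hom_component[OF \<Phi> _ _ j] distrib_left sum.distrib)

theorem theorem3p6:
  fixes X :: "'x rel" and P :: "'p rel"
    and I :: "('x, 'k::field) pmod set"
    and F E :: "('x \<Rightarrow> 'p) set"
  assumes "finite_poset X" and "finite_poset P"
    and "rep_finite TYPE('k) X"
    and "is_Ind X I"
    and "is_Emb X P F"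
    and "E \<subseteq> F"
  shows "equivalent_invariants P
           (E \<times> I) (mult_invariant X P E I)
           (E \<times> I) (dimh_invariant X P E I)"
proof -
  have X: "finite X" using assms(1) by (simp add: finite_poset_def)
  have finI: "finite I" using is_Ind_finite[OF assms(3,4)] .
  note I = assms(4) finI
  have emb: "f \<in> order_embeddings X P" if "f \<in> E" for f
    using assms(5,6) that unfolding is_Emb_def representatives_def by blast
  let ?K = "K0sp P :: (('p, 'k) pmod set \<Rightarrow>\<^sub>0 int) set monoid"
  define \<Phi> where "\<Phi> = mult_invariant X P E I"
  define \<Psi> where "\<Psi> = dimh_invariant X P E I"
  define \<mu> where "\<mu> = (\<lambda>(M :: ('p, 'k) pmod) (f, U). int (summand_mult X U (restrict_along f M)))"
  define \<eta> where "\<eta> = (\<lambda>(M :: ('p, 'k) pmod) (f, U). int (dim_Hom X U (restrict_along f M)))"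
  have \<mu>: "additive_on_pmods P (\<lambda>M. \<mu> M j)" if "j \<in> E \<times> I" for j
    using that additive_restrict_along[OF emb additive_summand_mult[OF X I]] by (auto simp: \<mu>_def)
  have \<eta>: "additive_on_pmods P (\<lambda>M. \<eta> M j)" if "j \<in> E \<times> I" for j
    using that additive_restrict_along[OF emb additive_dim_Hom[OF X is_Ind_pmods[OF I(1)]]]
    by (auto simp: \<eta>_def)
  have \<Phi>: "\<Phi> \<in> hom ?K (int_power (E \<times> I))"
    unfolding \<Phi>_def mult_invariant_def \<mu>_def[symmetric] using \<mu> by (rule K0_extend_additive(1))
  have \<Psi>: "\<Psi> \<in> hom ?K (int_power (E \<times> I))"
    unfolding \<Psi>_def dimh_invariant_def \<eta>_def[symmetric] using \<eta> by (rule K0_extend_additive(1))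
  have \<Phi>M: "\<Phi> (K0_class P M) (f, U) = int (summand_mult X U (restrict_along f M))"
    if "M \<in> pmods P" "f \<in> E" "U \<in> I" for M f U
    using K0_extend_additive(2)[of "E \<times> I" P \<mu>, OF \<mu> that(1)] that
    by (simp add: \<Phi>_def mult_invariant_def \<mu>_def)
  have \<Psi>M: "\<Psi> (K0_class P M) (f, U) = int (dim_Hom X U (restrict_along f M))"
    if "M \<in> pmods P" "f \<in> E" "U \<in> I" for M f U
    using K0_extend_additive(2)[of "E \<times> I" P \<eta>, OF \<eta> that(1)] that
    by (simp add: \<Psi>_def dimh_invariant_def \<eta>_def)
  have \<Psi>\<Phi>: "\<Psi> c (f, U) = (\<Sum>V\<in>I. int (dim_Hom X U V) * \<Phi> c (f, V))"
    if f: "f \<in> E" and U: "U \<in> I" and c: "c \<in> carrier ?K" for f U c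
  proof (rule K0_hom_eqI[OF group_integer_group _ _ _ c])
    show "(\<lambda>c. \<Psi> c (f, U)) \<in> hom ?K integer_group"
      using lincomb_of_components_hom[OF \<Psi>, of "{()}" "\<lambda>_. (f, U)" "\<lambda>_. 1"] f U by simp
    show "(\<lambda>c. \<Sum>V\<in>I. int (dim_Hom X U V) * \<Phi> c (f, V)) \<in> hom ?K integer_group"
      using f by (intro lincomb_of_components_hom[OF \<Phi>]) simp
    show "\<Psi> (K0_class P M) (f, U) = (\<Sum>V\<in>I. int (dim_Hom X U V) * \<Phi> (K0_class P M) (f, V))"
      if M: "M \<in> pmods P" for M
      using dim_Hom_from_mult[OF X I is_Ind_pmods[OF I(1) U] restrict_along_pmods[OF emb[OF f] M]]
      by (simp add: \<Psi>M[OF M f U] \<Phi>M[OF M f])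
  qed
  have \<Phi>\<Psi>: "\<exists>e a. e > 0 \<and> (\<forall>c\<in>carrier ?K. e * \<Phi> c (f, U) = (\<Sum>V\<in>I. a V * \<Psi> c (f, V)))"
    if f: "f \<in> E" and U: "U \<in> I" for f U
  proof -
    obtain e a where e: "e > 0" and a: "\<And>M. M \<in> pmods X \<Longrightarrow>
        e * int (summand_mult X U M) = (\<Sum>V\<in>I. a V * int (dim_Hom X V M))"
      using mult_from_dim_Hom[OF X I U] by metis
    have "e * \<Phi> c (f, U) = (\<Sum>V\<in>I. a V * \<Psi> c (f, V))" if c: "c \<in> carrier ?K" for c
    proof (rule K0_hom_eqI[OF group_integer_group _ _ _ c])
      show "(\<lambda>c. e * \<Phi> c (f, U)) \<in> hom ?K integer_group"
        using lincomb_of_components_hom[OF \<Phi>, of "{()}" "\<lambda>_. (f, U)" "\<lambda>_. e"] f U by simp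
      show "(\<lambda>c. \<Sum>V\<in>I. a V * \<Psi> c (f, V)) \<in> hom ?K integer_group"
        using f by (intro lincomb_of_components_hom[OF \<Psi>]) simp
      show "e * \<Phi> (K0_class P M) (f, U) = (\<Sum>V\<in>I. a V * \<Psi> (K0_class P M) (f, V))"
        if M: "M \<in> pmods P" for M
        using a[OF restrict_along_pmods[OF emb[OF f] M]] by (simp add: \<Phi>M[OF M f U] \<Psi>M[OF M f])
    qed
    then show ?thesis using e by blast
  qed
  have "\<Phi> c = \<Phi> d \<longleftrightarrow> \<Psi> c = \<Psi> d" if cd: "c \<in> carrier ?K" "d \<in> carrier ?K" for c d
  proof
    assume eq: "\<Phi> c = \<Phi> d"
    have "\<Psi> c (f, U) = \<Psi> d (f, U)" if "f \<in> E" "U \<in> I" for f U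
      using \<Psi>\<Phi>[OF that cd(1)] \<Psi>\<Phi>[OF that cd(2)] eq by simp
    then show "\<Psi> c = \<Psi> d"
      using hom_in_carrier[OF \<Psi> cd(1)] hom_in_carrier[OF \<Psi> cd(2)]
      by (intro PiE_ext[of "\<Psi> c" "E \<times> I" "\<lambda>_. UNIV"]) auto
  next
    assume eq: "\<Psi> c = \<Psi> d"
    have "\<Phi> c (f, U) = \<Phi> d (f, U)" if fU: "f \<in> E" "U \<in> I" for f U
    proof -
      obtain e a where e: "e > 0" and a: "\<forall>c\<in>carrier ?K. e * \<Phi> c (f, U) = (\<Sum>V\<in>I. a V * \<Psi> c (f, V))"
        using \<Phi>\<Psi>[OF fU] by blast
      have "e * \<Phi> c (f, U) = e * \<Phi> d (f, U)" using a cd eq by simp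
      then show ?thesis using e by simp
    qed
    then show "\<Phi> c = \<Phi> d"
      using hom_in_carrier[OF \<Phi> cd(1)] hom_in_carrier[OF \<Phi> cd(2)]
      by (intro PiE_ext[of "\<Phi> c" "E \<times> I" "\<lambda>_. UNIV"]) auto
  qed
  then show ?thesis
    using equivalent_invariants_if_same_fibres[OF \<Phi> \<Psi>] unfolding \<Phi>_def \<Psi>_def by blast
qed

end
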